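(* Let $n\ge1$ and let $\alpha,\beta\in\mathbb C^n$ satisfy $\Re\alpha_j+\Re\beta_j>-1$ and $\alpha_j,\beta_j\notin\{-1,-2,\ldots\}$ for all $1\le j\le n$. Let $u=P_{\alpha,\beta}[f]$ where $f\in L^\infty(\mathbb T^n)$. Then $u_{\mathbf r}$ converges weak$^\ast$ to $f$ (in $L^\infty(\mathbb T^n)=L^1(\mathbb T^n)^\ast$) as $\mathbf r=(r_1,\ldots,r_n)\to(1,\ldots,1)$ in $[0,1)^n$.
   Context: $\mathbb D$ is the open unit disc and $\mathbb T$ the unit circle; $m_n$ is the normalized Haar measure on $\mathbb T^n$, and $L^p(\mathbb T^n)$ is taken with respect to $m_n$. The duality between $L^1(\mathbb T^n)$ and $L^\infty(\mathbb T^n)$ is given by $\int_{\mathbb T^n}\varphi f\,dm_n$. For $u:\mathbb D^n\to\mathbb C$ and $\mathbf r\in[0,1)^n$, $u_{\mathbf r}(\zeta)=u(r_1\zeta_1,\ldots,r_n\zeta_n)$, $\zeta\in\mathbb T^n$. The $(\alpha,\beta)$-Poisson kernel is, for $z\in\mathbb D^n$, $\zeta\in\mathbb T^n$ (principal branches of powers), $$P_{\alpha,\beta}(z,\zeta)=\prod_{j=1}^n c_{\alpha_j,\beta_j}\frac{(1-|z_j|^2)^{\alpha_j+\beta_j+1}}{(1-z_j\overline{\zeta_j})^{\alpha_j+1}(1-\overline{z_j}\zeta_j)^{\beta_j+1}},\qquad c_{a,b}=\frac{\Gamma(a+1)\Gamma(b+1)}{\Gamma(a+b+1)},$$ and $P_{\alpha,\beta}[f](z)=\int_{\mathbb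 T^n}P_{\alpha,\beta}(z,\zeta)f(\zeta)\,dm_n(\zeta)$, $z\in\mathbb D^n$. *)

theory Defs
  imports "HOL-Probability.Probability"
begin

definition polydisc :: "(complex ^ 'n) set" where
  "polydisc = {z. \<forall>j. norm (z $ j) < 1}"

definition torus :: "(complex ^ 'n) set" where
  "torus = {\<zeta>. \<forall>j. norm (\<zeta> $ j) = 1}"

definition circle_measure :: "complex measure" where
  "circle_measure = distr (uniform_measure lborel {0..2 * pi}) (restrict_space borel (sphere 0 1)) cis"

text \<open>
  The normalized Haar measure of the torus is the product of the normalized arc length
  measures of its factors, transported from functions \<open>'n \<Rightarrow> complex\<close> to vectors.
  Its \<open>\<sigma>\<close>-algebra is the Borel one; every class in \<open>L\<^sup>p\<close> has a Borel representative.
\<close>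

definition torus_measure :: "(complex ^ 'n) measure" where
  "torus_measure =
     distr (Pi\<^sub>M UNIV (\<lambda>_::'n. circle_measure)) (restrict_space borel torus) vec_lambda"

definition L_infinity :: "'a measure \<Rightarrow> ('a \<Rightarrow> complex) set" where
  "L_infinity M = {f \<in> borel_measurable M. \<exists>C::real. AE x in M. norm (f x) \<le> C}"

text \<open>
  Convergence in the topology on \<open>L\<^sup>\<infinity>\<close> induced by the bilinear (not sesquilinear) pairing with
  \<open>L\<^sup>1\<close>. This is meaningful only for families and limits in \<^const>\<open>L_infinity\<close>, since
  the Bochner integral of a non-integrable function is \<open>0\<close>.
\<close>

definition weak_star_tendsto ::
    "'a measure \<Rightarrow> ('r \<Rightarrow> 'a \<Rightarrow> complex) \<Rightarrow> ('a \<Rightarrow> complex) \<Rightarrow> 'r filter \<Rightarrow> bool" where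
  "weak_star_tendsto M F f G \<longleftrightarrow>
     (\<forall>\<phi> :: 'a \<Rightarrow> complex. integrable M \<phi> \<longrightarrow>
        ((\<lambda>r. LINT x|M. \<phi> x * F r x) \<longlongrightarrow> (LINT x|M. \<phi> x * f x)) G)"

definition poisson_const :: "complex \<Rightarrow> complex \<Rightarrow> complex" where
  "poisson_const a b = Gamma (a + 1) * Gamma (b + 1) / Gamma (a + b + 1)"

definition poisson_kernel ::
    "complex ^ 'n \<Rightarrow> complex ^ 'n \<Rightarrow> complex ^ 'n \<Rightarrow> complex ^ 'n \<Rightarrow> complex" where
  "poisson_kernel \<alpha> \<beta> z \<zeta> =
     (\<Prod>j\<in>UNIV. poisson_const (\<alpha> $ j) (\<beta> $ j) *
        (complex_of_real (1 - (norm (z $ j))\<^sup>2) powr (\<alpha> $ j + \<beta> $ j + 1) /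
         ((1 - z $ j * cnj (\<zeta> $ j)) powr (\<alpha> $ j + 1) *
          (1 - cnj (z $ j) * \<zeta> $ j) powr (\<beta> $ j + 1))))"

definition poisson_integral ::
    "complex ^ 'n \<Rightarrow> complex ^ 'n \<Rightarrow> (complex ^ 'n \<Rightarrow> complex) \<Rightarrow> complex ^ 'n \<Rightarrow> complex" where
  "poisson_integral \<alpha> \<beta> f z =
     (LINT \<zeta>|torus_measure. poisson_kernel \<alpha> \<beta> z \<zeta> * f \<zeta>)"

definition dilation ::
    "(complex ^ 'n \<Rightarrow> complex) \<Rightarrow> real ^ 'n \<Rightarrow> complex ^ 'n \<Rightarrow> complex" where
  "dilation u r \<zeta> = u (\<chi> j. complex_of_real (r $ j) * \<zeta> $ j)"

end

theory Submission
  imports Defs "HOL-Complex_Analysis.Cauchy_Integral_Theorem" "HOL-Real_Asymp.Real_Asymp"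
begin

text \<open>
  The kernel at radius \<open>r\<close> acts on functions on the torus as a Fourier multiplier. In one variable,
  expanding both complex powers into binomial series and integrating term by term shows that the
  character \<open>w\<^sup>m\<close> is multiplied by
  \<open>c (1 - r\<^sup>2)\<^bsup>a+b+1\<^esup> \<Sum>\<^sub>n p\<^sub>n q\<^bsub>n+m\<^esub> r\<^bsup>2n+m\<^esup>\<close>, where \<open>p\<close> and \<open>q\<close> are the Taylor coefficients
  of \<open>(1 - x)\<^bsup>-a-1\<^esup>\<close> and \<open>(1 - x)\<^bsup>-b-1\<^esup>\<close>. These products are asymptotic to
  \<open>n\<^bsup>a+b\<^esup> / (\<Gamma>(a+1) \<Gamma>(b+1))\<close>, so an Abelian theorem (\<open>abel_asymptotic\<close>) gives the behaviour of the
  sum as \<open>r \<rightarrow> 1\<close>, and the constant \<open>c\<close> is such that the multiplier tends to \<open>1\<close>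
  (\<open>poisson_const_kernel_multiplier_tendsto\<close>). The condition \<open>Re a + Re b > -1\<close> is what makes the sum
  diverge at the rate of a positive power.

  The same computation bounds the \<open>L\<^sup>1\<close> norm of the kernel: its modulus is at most a constant
  times the kernel with both parameters replaced by the mean of their real parts, which is positive, so that its norm
  is its integral (\<open>disc_kernel_L1\<close>). Everything factors over the coordinates of the torus. The
  dilations \<open>u\<^sub>r\<close> are therefore bounded in \<open>L\<^sup>\<infinity>\<close> for \<open>r\<close> near \<open>(1, ..., 1)\<close>, and by Fubini's theorem
  the integral of \<open>u\<^sub>r\<close> against a monomial tends to that of \<open>f\<close> (\<open>poisson_integral_monomial\<close>).

  For a bounded net, convergence against monomials implies convergence against all of \<open>L\<^sup>1\<close>: monomials
  span a uniformly dense space of continuous functions by the Stone--Weierstrass theorem, and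
  continuous functions are dense in \<open>L\<^sup>1\<close> (the locales \<open>bounded_net\<close>, \<open>bounded_net_metric\<close> and
  \<open>torus_net\<close>).
\<close>

section \<open>Abelian asymptotics for binomial series\<close>

text \<open>
  The power \<open>n\<^sup>w\<close> with complex exponent. The value at \<open>n = 0\<close> is \<open>1\<close>, so that quotients of such powers
  never divide by zero.
\<close>
definition npow :: "complex \<Rightarrow> nat \<Rightarrow> complex" where
  "npow w n = exp (w * of_real (ln (real n)))"

text \<open>
  The Taylor coefficients of \<open>(1 - x)\<^bsup>-z\<^esup>\<close>.
\<close>
definition neg_binomial_coeff :: "complex \<Rightarrow> nat \<Rightarrow> complex" where
  "neg_binomial_coeff z n = pochhammer z n / fact n"

lemma neg_binomial_coeff_gbinomial: "neg_binomial_coeff z n = (-1) ^ n * ((- z) gchoose n)"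
  by (simp add: neg_binomial_coeff_def gbinomial_pochhammer mult.assoc[symmetric] power_mult_distrib[symmetric])

lemma neg_binomial_sums:
  assumes "norm x < 1"
  shows "(\<lambda>n. neg_binomial_coeff z n * x ^ n) sums ((1 - x) powr (- z))"
proof -
  have "(\<lambda>n. ((-z) gchoose n) * (-x)^n) sums (1 + -x) powr (- z)"
    by (rule gen_binomial_complex) (use assms in simp)
  moreover have "((-z) gchoose n) * (-x)^n = neg_binomial_coeff z n * x ^ n" for n
    by (simp add: neg_binomial_coeff_gbinomial power_minus[of x])
  ultimately show ?thesis by simp
qed

text \<open>
  The coefficients of \<open>(1 - x)\<^bsup>-z\<^esup>\<close> grow like \<open>n\<^bsup>z-1\<^esup>\<close>; Euler's limit formula identifies the constant.
  The reciprocal Gamma function covers the non-positive integers \<open>z\<close>, where the series terminates,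
  without a case distinction.
\<close>
lemma neg_binomial_coeff_asymp:
  "(\<lambda>n. neg_binomial_coeff z n / npow (z - 1) n) \<longlonglongrightarrow> rGamma z"
proof -
  have "(\<lambda>n. ((-z) gchoose n) / ((-1)^n / exp ((-z+1) * of_real (ln (real n))))) \<longlonglongrightarrow> inverse (Gamma (- (-z)))"
    by (rule gbinomial_asymptotic)
  moreover have "((-z) gchoose n) / ((-1)^n / exp ((-z+1) * of_real (ln (real n)))) = neg_binomial_coeff z n / npow (z - 1) n" for n
  proof -
    have "exp ((-z+1) * of_real (ln (real n))) = inverse (npow (z - 1) n)"
      unfolding npow_def exp_minus[symmetric] by (simp add: algebra_simps)
    moreover have "inverse ((-1::complex)^n) = (-1)^n" by (simp flip: power_inverse)
    ultimately show ?thesis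
      by (simp add: neg_binomial_coeff_gbinomial divide_inverse)
  qed
  ultimately show ?thesis by (simp add: rGamma_inverse_Gamma)
qed

lemma npow_nonzero [simp]: "npow w n \<noteq> 0" by (simp add: npow_def)
lemma npow_add: "npow (v + w) n = npow v n * npow w n" by (simp add: npow_def algebra_simps exp_add)
lemma norm_npow: "norm (npow w n) = norm (npow (of_real (Re w)) n)" by (simp add: npow_def)

text \<open>
  Multiplying by \<open>w\<^sup>m\<close> on the circle shifts Fourier coefficients by \<open>m\<close>, which may be negative;
  indices that fall below zero contribute nothing. Treating both signs of \<open>m\<close> by one padded shift
  avoids proving everything twice.
\<close>
definition shift_seq :: "int \<Rightarrow> (nat \<Rightarrow> complex) \<Rightarrow> nat \<Rightarrow> complex" where
  "shift_seq m q n = (if 0 \<le> int n + m then q (nat (int n + m)) else 0)"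

lemma shift_seq_asymp:
  assumes "(\<lambda>n. q n / npow w n) \<longlonglongrightarrow> L"
  shows "(\<lambda>n. shift_seq m q n / npow w n) \<longlonglongrightarrow> L"
proof -
  have lim: "filterlim (\<lambda>n. nat (int n + m)) at_top sequentially"
    unfolding filterlim_at_top eventually_sequentially
  proof (intro allI)
    fix Z show "\<exists>N. \<forall>n\<ge>N. Z \<le> nat (int n + m)" by (rule exI[of _ "Z + nat \<bar>m\<bar>"]) auto
  qed
  have "(\<lambda>n. q (nat (int n + m)) / npow w (nat (int n + m))) \<longlonglongrightarrow> L"
    using filterlim_compose[OF assms lim] .
  moreover have "(\<lambda>n. npow w (nat (int n + m)) / npow w n) \<longlonglongrightarrow> 1"
  proof -
    have "(\<lambda>n. ln (real n + m) - ln (real n)) \<longlonglongrightarrow> 0"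
      by real_asymp
    then have "(\<lambda>n. exp (w * of_real (ln (real n + m) - ln (real n)))) \<longlonglongrightarrow> exp (w * of_real 0)"
      by (intro tendsto_intros)
    moreover have "\<forall>\<^sub>F n in sequentially. exp (w * of_real (ln (real n + m) - ln (real n))) = npow w (nat (int n + m)) / npow w n"
      using eventually_ge_at_top[of "nat \<bar>m\<bar>"]
    proof eventually_elim
      case (elim n)
      then have "real (nat (int n + m)) = real n + m" by linarith
      then show ?case by (simp add: npow_def exp_diff algebra_simps)
    qed
    ultimately show ?thesis by (simp add: tendsto_cong)
  qed
  ultimately have "(\<lambda>n. (q (nat (int n + m)) / npow w (nat (int n + m))) * (npow w (nat (int n + m)) / npow w n)) \<longlonglongrightarrow> L * 1"
    by (rule tendsto_mult)
  moreover have "\<forall>\<^sub>F n in sequentially. (q (nat (int n + m)) / npow w (nat (int n + m))) * (npow w (nat (int n + m)) / npow w n) = shift_seq m q n / npow w n"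
      (is "\<forall>\<^sub>F n in _. ?l n = ?r n")
    using eventually_ge_at_top[of "nat \<bar>m\<bar>"]
  proof eventually_elim
    case (elim n)
    then show ?case by (simp add: shift_seq_def)
  qed
  ultimately show ?thesis
    by (simp only: tendsto_cong[of ?l ?r] mult_1_right)
qed

text \<open>
  For \<open>\<sigma> > 0\<close> the coefficients are positive, so they serve as a majorant with a known sum.
\<close>
lemma norm_neg_binomial_coeff_real:
  assumes "\<sigma> > 0"
  shows "neg_binomial_coeff (of_real \<sigma>) n = of_real (norm (neg_binomial_coeff (of_real \<sigma>) n))"
    and "norm (neg_binomial_coeff (of_real \<sigma>) n) > 0"
proof -
  have "neg_binomial_coeff (of_real \<sigma>) n = of_real (pochhammer \<sigma> n / fact n)"
    by (simp add: neg_binomial_coeff_def pochhammer_of_real)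
  moreover have "pochhammer \<sigma> n / fact n > 0" using assms by (simp add: pochhammer_pos)
  ultimately have "neg_binomial_coeff (of_real \<sigma>) n = of_real (pochhammer \<sigma> n / fact n) \<and>
      norm (neg_binomial_coeff (of_real \<sigma>) n) = pochhammer \<sigma> n / fact n \<and> pochhammer \<sigma> n / fact n > 0"
    by (metis norm_of_real abs_of_pos)
  then show "neg_binomial_coeff (of_real \<sigma>) n = of_real (norm (neg_binomial_coeff (of_real \<sigma>) n))"
    "norm (neg_binomial_coeff (of_real \<sigma>) n) > 0"
    by auto
qed

lemma neg_binomial_real_sums:
  assumes "\<sigma> > 0" "0 \<le> x" "x < 1"
  shows "(\<lambda>n. norm (neg_binomial_coeff (of_real \<sigma>) n) * x ^ n) sums ((1 - x) powr (- \<sigma>))"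
proof -
  have "(\<lambda>n. neg_binomial_coeff (of_real \<sigma>) n * of_real x ^ n) sums ((1 - of_real x) powr (- of_real \<sigma>))"
    by (rule neg_binomial_sums) (use assms in simp)
  moreover have "(1 - of_real x :: complex) powr (- of_real \<sigma>) = of_real ((1 - x) powr (- \<sigma>))"
    using powr_of_real[of "1 - x" "- \<sigma>"] assms by simp
  moreover have "neg_binomial_coeff (of_real \<sigma>) n * of_real x ^ n = of_real (norm (neg_binomial_coeff (of_real \<sigma>) n) * x ^ n)" for n
    by (subst norm_neg_binomial_coeff_real(1)[OF assms(1)]) simp
  ultimately show ?thesis by (simp only: sums_of_real_iff)
qed

text \<open>
  A comparison with \<open>n\<^bsup>s-1\<^esup>\<close> amounts to a comparison with the positive coefficients of
  \<open>(1 - x)\<^bsup>-Re s\<^esup>\<close>, because these grow like \<open>n\<^bsup>Re s - 1\<^esup>\<close> and, in contrast to the powers, have a series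
  with a closed form.
\<close>
lemma asymp_quotient:
  assumes "Re s > 0" "(\<lambda>n. A n / npow (s - 1) n) \<longlonglongrightarrow> l"
  shows "(\<lambda>n. norm (A n) / norm (neg_binomial_coeff (of_real (Re s)) n)) \<longlonglongrightarrow> norm l * norm (Gamma (of_real (Re s) :: complex))"
proof -
  let ?e = "neg_binomial_coeff (of_real (Re s))"
  have nz: "Gamma (of_real (Re s) :: complex) \<noteq> 0"
    using assms(1) by (subst Gamma_eq_zero_iff) (auto elim!: nonpos_Ints_cases simp: complex_eq_iff)
  have "(\<lambda>n. ?e n / npow (of_real (Re s) - 1) n) \<longlonglongrightarrow> rGamma (of_real (Re s))"
    by (rule neg_binomial_coeff_asymp)
  with assms(2) have "(\<lambda>n. norm (A n / npow (s - 1) n) / norm (?e n / npow (of_real (Re s) - 1) n)) \<longlonglongrightarrow> norm l / norm (rGamma (of_real (Re s) :: complex))"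
    using nz by (intro tendsto_intros) (auto simp: rGamma_inverse_Gamma)
  moreover have "norm (A n / npow (s - 1) n) / norm (?e n / npow (of_real (Re s) - 1) n) = norm (A n) / norm (?e n)" for n
    using norm_npow[of "s - 1" n] by (simp add: norm_divide)
  moreover have "norm l / norm (rGamma (of_real (Re s) :: complex)) = norm l * norm (Gamma (of_real (Re s) :: complex))"
    by (simp add: rGamma_inverse_Gamma norm_inverse divide_inverse)
  ultimately show ?thesis by (simp only:)
qed

lemma asymp_summable:
  assumes "Re s > 0" "(\<lambda>n. A n / npow (s - 1) n) \<longlonglongrightarrow> l" "norm x < 1"
  shows "summable (\<lambda>n. norm (A n * x ^ n))"
proof -
  let ?e = "\<lambda>n. norm (neg_binomial_coeff (of_real (Re s)) n)"
  have "Bseq (\<lambda>n. norm (A n) / ?e n)"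
    using asymp_quotient[OF assms(1,2)] convergentI convergent_imp_Bseq by blast
  then obtain B where B: "\<And>n. norm (A n) / ?e n \<le> B"
    by (auto simp: Bseq_def)
  have pos: "?e n > 0" for n using norm_neg_binomial_coeff_real(2)[OF assms(1)] .
  have "summable (\<lambda>n. B * (?e n * norm x ^ n))"
    using neg_binomial_real_sums[OF assms(1), of "norm x"] assms(3) by (intro summable_mult) (auto simp: sums_iff)
  then show ?thesis
  proof (rule summable_comparison_test'[of _ 0])
    fix n :: nat
    have "norm (A n) \<le> B * ?e n" using B[of n] pos[of n] by (simp add: field_simps)
    then show "norm (norm (A n * x ^ n)) \<le> B * (?e n * norm x ^ n)"
      by (simp add: norm_mult norm_power mult_right_mono mult.assoc[symmetric])
  qed
qed

text \<open>
  Coefficients that are negligible against \<open>n\<^bsup>s-1\<^esup>\<close> give a sum that is negligible against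
  \<open>(1 - x)\<^bsup>-s\<^esup>\<close>: all but finitely many terms are dominated by \<open>\<epsilon>\<close> times the positive series with sum
  \<open>(1 - x)\<^bsup>-Re s\<^esup>\<close>, and the finitely many remaining terms stay bounded while the factor
  \<open>(1 - x)\<^sup>s\<close> tends to \<open>0\<close>.
\<close>
lemma abel_null:
  assumes s: "Re s > 0" and lim: "(\<lambda>n. d n / npow (s - 1) n) \<longlonglongrightarrow> 0"
  shows "((\<lambda>x. of_real (1 - x) powr s * (\<Sum>n. d n * of_real x ^ n)) \<longlongrightarrow> 0) (at_left 1)"
proof (rule tendstoI)
  fix \<epsilon> :: real assume \<epsilon>: "\<epsilon> > 0"
  define e where "e = (\<lambda>n. norm (neg_binomial_coeff (of_real (Re s)) n))"
  have pos: "e n > 0" for n using norm_neg_binomial_coeff_real(2)[OF s] by (simp add: e_def)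
  have "(\<lambda>n. norm (d n) / e n) \<longlonglongrightarrow> 0"
    using asymp_quotient[OF s lim] by (simp add: e_def)
  then have "\<forall>\<^sub>F n in sequentially. norm (d n) / e n < \<epsilon> / 2"
    by (rule order_tendstoD) (use \<epsilon> in simp)
  then obtain N where N: "\<And>n. n \<ge> N \<Longrightarrow> norm (d n) / e n < \<epsilon> / 2"
    by (auto simp: eventually_sequentially)
  have N': "norm (d n) \<le> \<epsilon> / 2 * e n" if "n \<ge> N" for n
    using N[OF that] pos[of n] by (simp add: field_simps)
  define S where "S = (\<Sum>n<N. norm (d n))"
  have "((\<lambda>x::real. (1 - x) powr Re s * S + \<epsilon> / 2) \<longlongrightarrow> (1 - 1) powr Re s * S + \<epsilon> / 2) (at_left 1)"
    using s by (intro tendsto_intros) (auto simp: eventually_at_filter)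
  then have "\<forall>\<^sub>F x in at_left (1::real). (1 - x) powr Re s * S + \<epsilon> / 2 < \<epsilon>"
    by (rule order_tendstoD) (use \<epsilon> in simp)
  moreover have "\<forall>\<^sub>F x in at_left (1::real). 0 < x \<and> x < 1"
    using eventually_at_left_real[of 0 1] by simp
  ultimately show "\<forall>\<^sub>F x in at_left 1. dist (of_real (1 - x) powr s * (\<Sum>n. d n * of_real x ^ n)) 0 < \<epsilon>"
  proof eventually_elim
    case (elim x)
    have sd: "summable (\<lambda>n. norm (d n * of_real x ^ n))"
      by (rule asymp_summable[OF s lim]) (use elim in simp)
    have se: "(\<lambda>n. e n * x ^ n) sums ((1 - x) powr (- Re s))"
      using neg_binomial_real_sums[OF s, of x] elim by (simp add: e_def)
    have "norm (\<Sum>n. d n * of_real x ^ n) \<le> (\<Sum>n. norm (d n * of_real x ^ n))"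
      by (rule summable_norm[OF sd])
    also have "\<dots> = (\<Sum>n. norm (d (n + N) * of_real x ^ (n + N))) + (\<Sum>n<N. norm (d n * of_real x ^ n))"
      by (rule suminf_split_initial_segment[OF sd])
    also have "(\<Sum>n<N. norm (d n * of_real x ^ n)) \<le> S"
      unfolding S_def using elim by (intro sum_mono) (simp add: norm_mult norm_power mult_left_le power_le_one)
    also have "(\<Sum>n. norm (d (n + N) * of_real x ^ (n + N))) \<le> (\<Sum>n. \<epsilon> / 2 * (e (n + N) * x ^ (n + N)))"
    proof (rule suminf_le)
      fix n
      have "norm (d (n + N) * of_real x ^ (n + N)) = norm (d (n + N)) * x ^ (n + N)"
        using elim by (simp add: norm_mult norm_power)
      also have "\<dots> \<le> \<epsilon> / 2 * e (n + N) * x ^ (n + N)"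
        using elim by (intro mult_right_mono N') auto
      finally show "norm (d (n + N) * of_real x ^ (n + N)) \<le> \<epsilon> / 2 * (e (n + N) * x ^ (n + N))" by (simp add: mult.assoc)
    next
      show "summable (\<lambda>n. norm (d (n + N) * of_real x ^ (n + N)))"
        using summable_ignore_initial_segment[OF sd, of N] .
      show "summable (\<lambda>n. \<epsilon> / 2 * (e (n + N) * x ^ (n + N)))"
        using summable_ignore_initial_segment[OF sums_summable[OF se], of N] by (rule summable_mult)
    qed
    also have "(\<Sum>n. \<epsilon> / 2 * (e (n + N) * x ^ (n + N))) = \<epsilon> / 2 * (\<Sum>n. e (n + N) * x ^ (n + N))"
      using summable_ignore_initial_segment[OF sums_summable[OF se], of N] by (rule suminf_mult)
    also have "(\<Sum>n. e (n + N) * x ^ (n + N)) \<le> (1 - x) powr (- Re s)"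
    proof -
      have "(\<Sum>n. e (n + N) * x ^ (n + N)) = (\<Sum>n. e n * x ^ n) - (\<Sum>n<N. e n * x ^ n)"
        by (rule suminf_minus_initial_segment[OF sums_summable[OF se]])
      also have "\<dots> \<le> (\<Sum>n. e n * x ^ n)"
        using elim by (simp add: sum_nonneg e_def)
      finally show ?thesis using se by (simp add: sums_iff)
    qed
    finally have *: "norm (\<Sum>n. d n * of_real x ^ n) \<le> \<epsilon> / 2 * (1 - x) powr (- Re s) + S"
      using \<epsilon> by simp
    have "norm (of_real (1 - x) powr s * (\<Sum>n. d n * of_real x ^ n)) = (1 - x) powr Re s * norm (\<Sum>n. d n * of_real x ^ n)"
      using elim by (subst norm_mult, subst norm_powr_real_powr) auto
    also have "\<dots> \<le> (1 - x) powr Re s * (\<epsilon> / 2 * (1 - x) powr (- Re s) + S)"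
      by (intro mult_left_mono *) simp
    also have "\<dots> = (1 - x) powr Re s * S + \<epsilon> / 2"
      using elim by (simp add: powr_minus field_simps)
    finally show ?case using elim by (simp add: dist_norm)
  qed
qed

text \<open>
  Subtracting the multiple of \<open>(1 - x)\<^bsup>-s\<^esup>\<close> whose coefficients have the same asymptotics leaves the
  negligible case. This replaces the evaluation of the hypergeometric function at \<open>1\<close> by Gauss's
  summation formula.
\<close>
lemma abel_asymptotic:
  assumes s: "Re s > 0" and lim: "(\<lambda>n. A n / npow (s - 1) n) \<longlonglongrightarrow> l"
  shows "((\<lambda>x. of_real (1 - x) powr s * (\<Sum>n. A n * of_real x ^ n)) \<longlongrightarrow> l * Gamma s) (at_left 1)"
proof -
  let ?e = "neg_binomial_coeff s"
  have nz: "Gamma s \<noteq> 0"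
    using s by (subst Gamma_eq_zero_iff) (auto elim!: nonpos_Ints_cases)
  define d where "d = (\<lambda>n. A n - l * Gamma s * ?e n)"
  have "(\<lambda>n. A n / npow (s - 1) n - l * Gamma s * (?e n / npow (s - 1) n)) \<longlonglongrightarrow> l - l * Gamma s * rGamma s"
    by (intro tendsto_intros lim neg_binomial_coeff_asymp)
  moreover have "l - l * Gamma s * rGamma s = 0" using nz by (simp add: rGamma_inverse_Gamma)
  ultimately have dlim: "(\<lambda>n. d n / npow (s - 1) n) \<longlonglongrightarrow> 0"
    by (simp add: d_def diff_divide_distrib)
  have "((\<lambda>x. of_real (1 - x) powr s * (\<Sum>n. d n * of_real x ^ n) + l * Gamma s) \<longlongrightarrow> 0 + l * Gamma s) (at_left 1)"
    by (intro tendsto_intros abel_null[OF s dlim])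
  moreover have "\<forall>\<^sub>F x in at_left (1::real). 0 < x \<and> x < 1"
    using eventually_at_left_real[of 0 1] by simp
  then have "\<forall>\<^sub>F x in at_left (1::real). of_real (1 - x) powr s * (\<Sum>n. d n * of_real x ^ n) + l * Gamma s
      = of_real (1 - x) powr s * (\<Sum>n. A n * of_real x ^ n)"
  proof eventually_elim
    case (elim x)
    then have x: "norm (of_real x :: complex) < 1" by simp
    have "(\<lambda>n. A n * of_real x ^ n - l * Gamma s * (?e n * of_real x ^ n)) sums
       ((\<Sum>n. A n * of_real x ^ n) - l * Gamma s * (1 - of_real x) powr (- s))"
      by (intro sums_diff sums_mult neg_binomial_sums x summable_sums summable_norm_cancel[OF asymp_summable[OF s lim x]])
    then have "(\<Sum>n. d n * of_real x ^ n) = (\<Sum>n. A n * of_real x ^ n) - l * Gamma s * (1 - of_real x) powr (- s)"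
      by (simp add: d_def sums_iff algebra_simps)
    moreover have "of_real (1 - x) powr s * (1 - of_real x) powr (- s) = (1::complex)"
      using elim by (simp add: powr_minus)
    ultimately show ?case by algebra
  qed
  ultimately show ?thesis by (simp add: tendsto_cong)
qed

section \<open>Fourier coefficients on the circle\<close>
lemma sets_circle_measure: "sets circle_measure = sets (restrict_space borel (sphere 0 1))"
  by (simp add: circle_measure_def)

lemma space_circle_measure: "space circle_measure = sphere 0 1"
  by (simp add: circle_measure_def space_restrict_space)

lemma measurable_cis_circle: "cis \<in> borel \<rightarrow>\<^sub>M restrict_space borel (sphere 0 1)"
proof (rule measurable_restrict_space2)
  show "cis \<in> borel_measurable borel"
    by (intro borel_measurable_continuous_onI continuous_intros)
qed auto

lemma prob_space_circle_measure: "prob_space circle_measure"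
proof -
  interpret U: prob_space "uniform_measure lborel {0..2 * pi}"
    by (rule prob_space_uniform_measure) auto
  show ?thesis unfolding circle_measure_def
    by (rule U.prob_space_distr) (use measurable_cis_circle in simp)
qed

lemma borel_measurable_circleI: "f \<in> borel_measurable borel \<Longrightarrow> f \<in> borel_measurable circle_measure"
  unfolding measurable_cong_sets[OF sets_circle_measure refl] by (rule measurable_restrict_space1)

lemma measurable_power_int [measurable]:
  fixes f :: "'a \<Rightarrow> complex"
  assumes [measurable]: "f \<in> borel_measurable M"
  shows "(\<lambda>x. f x powi k) \<in> borel_measurable M"
  unfolding power_int_def by measurable

lemma cnj_eq_inverse:
  assumes "norm w = 1"
  shows "cnj w = inverse w"
  using assms by (simp add: inverse_complex_def complex_eq_iff cmod_def)

lemma circle_moment: "(LINT w|circle_measure. w powi k) = (if k = 0 then 1 else 0)"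
proof (cases "k = 0")
  case True
  interpret prob_space circle_measure by (rule prob_space_circle_measure)
  show ?thesis using True by (simp add: prob_space)
next
  case False
  define F where "F = (\<lambda>x. cis (of_int k * x) / (\<i> * of_int k))"
  have "(LINT w|circle_measure. w powi k) = (LINT x|uniform_measure lborel {0..2 * pi}. cis x powi k)"
    unfolding circle_measure_def
    by (rule integral_distr) (use measurable_cis_circle in \<open>auto intro!: measurable_restrict_space1\<close>)
  also have "uniform_measure lborel {0..2 * pi} = density lborel (\<lambda>x. ennreal (indicator {0..2 * pi} x / (2 * pi)))"
    unfolding uniform_measure_def
    using divide_ennreal[of 1 "2 * pi"] by (intro density_cong) (auto simp: indicator_def)
  also have "(LINT x|\<dots>. cis x powi k) = (LINT x|lborel. (indicator {0..2 * pi} x / (2 * pi)) *\<^sub>R (cis x powi k))"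
    by (rule integral_density) (auto simp: cis_power_int intro!: borel_measurable_continuous_onI continuous_intros)
  also have "\<dots> = (LINT x|lborel. (1 / (2 * pi)) *\<^sub>R (indicator {0..2 * pi} x *\<^sub>R cis (of_int k * x)))"
    by (simp add: cis_power_int)
  also have "\<dots> = (1 / (2 * pi)) *\<^sub>R (LINT x|lborel. indicator {0..2 * pi} x *\<^sub>R cis (of_int k * x))"
    by (rule integral_scaleR_right)
  also have "(LINT x|lborel. indicator {0..2 * pi} x *\<^sub>R cis (of_int k * x)) = F (2 * pi) - F 0"
  proof (rule integral_FTC_Icc)
    fix x :: real
    show "(F has_vector_derivative cis (of_int k * x)) (at x within {0..2 * pi})"
    proof -
      define w where "w = \<i> * complex_of_int k"
      have "w \<noteq> 0" using False by (simp add: w_def)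
      then have "((\<lambda>z. exp (w * z) / w) has_field_derivative exp (w * of_real x)) (at (complex_of_real x))"
        by (auto intro!: derivative_eq_intros)
      then have "((\<lambda>z. exp (\<i> * (of_int k * z)) / (\<i> * of_int k)) has_field_derivative
          exp (\<i> * (of_int k * of_real x))) (at (complex_of_real x))"
        by (simp only: w_def mult.assoc)
      from has_vector_derivative_real_field[OF this] show ?thesis
        unfolding F_def cis_conv_exp of_real_mult of_real_of_int_eq .
    qed
  qed (auto intro!: continuous_intros)
  also have "F (2 * pi) = F 0"
    using cis_multiple_2pi[of "of_int k"] by (simp add: F_def mult.commute)
  finally show ?thesis using False by simp
qed

text \<open>
  Parseval's identity for the product of an analytic and an anti-analytic absolutely convergent
  series, with an additional frequency shift \<open>m\<close>. Integrating the series one after the other reduces it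
  to the orthogonality of the characters.
\<close>
lemma fourier_product_sums:
  assumes P: "summable (\<lambda>n. norm (P n))" and Q: "summable (\<lambda>n. norm (Q n))"
  shows "(\<lambda>n. P n * shift_seq m Q n) sums
    (LINT w|circle_measure. w powi m * ((\<Sum>n. P n * w ^ n) * (\<Sum>n. Q n * cnj w ^ n)))"
proof -
  interpret prob_space circle_measure by (rule prob_space_circle_measure)
  have meas: "f \<in> borel_measurable circle_measure" if "f \<in> borel_measurable borel" for f :: "complex \<Rightarrow> complex"
    using that by (rule borel_measurable_circleI)
  define H where "H = (\<lambda>w. \<Sum>n. Q n * cnj w ^ n)"
  have cnj_meas [measurable]: "cnj \<in> borel_measurable borel"
    by (intro borel_measurable_continuous_onI continuous_intros)
  have H_meas [measurable]: "H \<in> borel_measurable borel"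
    unfolding H_def by measurable
  have norm_powi: "norm (w powi k) = 1" if "norm w = 1" for w :: complex and k
    using that by (simp add: norm_power_int)
  have Hs: "summable (\<lambda>n. norm (Q n * cnj w ^ n))" if "norm w = 1" for w
    using Q that by (simp add: norm_mult norm_power)
  define B where "B = (\<Sum>n. norm (Q n))"
  have HB: "norm (H w) \<le> B" if "norm w = 1" for w
  proof -
    have "norm (H w) \<le> (\<Sum>n. norm (Q n * cnj w ^ n))" unfolding H_def by (rule summable_norm[OF Hs[OF that]])
    then show ?thesis using that by (simp add: B_def norm_mult norm_power)
  qed
  \<comment> \<open>The anti-analytic factor has no positive frequencies, hence the zero for \<open>k < 0\<close>.\<close>
  have H_moment: "(LINT w|circle_measure. w powi k * H w) = (if 0 \<le> k then Q (nat k) else 0)" for k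
  proof -
    have "(LINT w|circle_measure. w powi k * H w) = (LINT w|circle_measure. (\<Sum>n. Q n * w powi (k - int n)))"
    proof (rule Bochner_Integration.integral_cong[OF refl])
      fix w assume "w \<in> space circle_measure"
      then have w: "norm w = 1" by (simp add: space_circle_measure)
      then have w0: "w \<noteq> 0" by auto
      have "cnj w = inverse w" by (rule cnj_eq_inverse[OF w])
      then have eq: "w powi k * (Q n * cnj w ^ n) = Q n * w powi (k - int n)" for n
        using w0 by (simp add: power_int_diff divide_inverse power_inverse)
      show "w powi k * H w = (\<Sum>n. Q n * w powi (k - int n))"
        unfolding H_def suminf_mult[OF summable_norm_cancel[OF Hs[OF w]], symmetric] eq ..
    qed
    also have "\<dots> = (\<Sum>n. LINT w|circle_measure. Q n * w powi (k - int n))"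
    proof (rule integral_suminf)
      show "integrable circle_measure (\<lambda>w. Q n * w powi (k - int n))" for n
        by (rule integrable_const_bound[where B = "norm (Q n)"])
          (auto simp: space_circle_measure norm_mult norm_powi intro!: AE_I2 meas)
      show "AE w in circle_measure. summable (\<lambda>n. norm (Q n * w powi (k - int n)))"
        using Q by (intro AE_I2) (simp add: space_circle_measure norm_mult norm_powi)
      have "(LINT w|circle_measure. norm (Q n * w powi (k - int n))) = (LINT w|circle_measure. norm (Q n))" for n
        by (rule Bochner_Integration.integral_cong) (auto simp: space_circle_measure norm_mult norm_powi)
      then show "summable (\<lambda>n. LINT w|circle_measure. norm (Q n * w powi (k - int n)))"
        using Q by (simp add: prob_space)
    qed
    also have "\<dots> = (\<Sum>n. if n = nat k then (if 0 \<le> k then Q (nat k) else 0) else 0)"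
      by (intro suminf_cong) (auto simp: circle_moment)
    also have "\<dots> = (if 0 \<le> k then Q (nat k) else 0)"
      using sums_single[of "nat k" "\<lambda>_. (if 0 \<le> k then Q (nat k) else 0)"] by (simp add: sums_iff)
    finally show ?thesis .
  qed
  have "(\<lambda>n. LINT w|circle_measure. P n * (w powi (m + int n) * H w)) sums
     (LINT w|circle_measure. (\<Sum>n. P n * (w powi (m + int n) * H w)))"
  proof (rule sums_integral)
    show int: "integrable circle_measure (\<lambda>w. P n * (w powi (m + int n) * H w))" for n
      by (rule integrable_const_bound[where B = "norm (P n) * B"])
        (auto simp: space_circle_measure norm_mult norm_powi intro!: AE_I2 meas mult_left_mono HB)
    show "AE w in circle_measure. summable (\<lambda>n. norm (P n * (w powi (m + int n) * H w)))"
      using P by (intro AE_I2) (auto simp: space_circle_measure norm_mult norm_powi intro!: summable_mult2)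
    show "summable (\<lambda>n. LINT w|circle_measure. norm (P n * (w powi (m + int n) * H w)))"
    proof (rule summable_comparison_test'[of "\<lambda>n. norm (P n) * B" 0])
      show "summable (\<lambda>n. norm (P n) * B)" using P by (rule summable_mult2)
      fix n :: nat
      have "(LINT w|circle_measure. norm (P n * (w powi (m + int n) * H w))) \<le> (LINT w|circle_measure. norm (P n) * B)"
        by (rule integral_mono[OF integrable_norm[OF int]])
          (auto simp: space_circle_measure norm_mult norm_powi intro!: mult_left_mono HB)
      then show "norm (LINT w|circle_measure. norm (P n * (w powi (m + int n) * H w))) \<le> norm (P n) * B"
        by (simp add: prob_space)
    qed
  qed
  moreover have "(LINT w|circle_measure. P n * (w powi (m + int n) * H w)) = P n * shift_seq m Q n" for n
    using H_moment[of "m + int n"] by (simp add: shift_seq_def add.commute)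
  moreover have "(LINT w|circle_measure. (\<Sum>n. P n * (w powi (m + int n) * H w))) =
      (LINT w|circle_measure. w powi m * ((\<Sum>n. P n * w ^ n) * (\<Sum>n. Q n * cnj w ^ n)))"
  proof (rule Bochner_Integration.integral_cong[OF refl])
    fix w assume "w \<in> space circle_measure"
    then have w: "norm w = 1" by (simp add: space_circle_measure)
    then have w0: "w \<noteq> 0" by auto
    have "summable (\<lambda>n. P n * w ^ n)"
      by (rule summable_norm_cancel) (use P w in \<open>simp add: norm_mult norm_power\<close>)
    then have "(\<Sum>n. P n * w ^ n) * (w powi m * H w) = (\<Sum>n. P n * w ^ n * (w powi m * H w))"
      by (rule suminf_mult2)
    also have "\<dots> = (\<Sum>n. P n * (w powi (m + int n) * H w))"
      using w0 by (intro suminf_cong) (simp add: power_int_add mult_ac)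
    finally show "(\<Sum>n. P n * (w powi (m + int n) * H w)) = w powi m * ((\<Sum>n. P n * w ^ n) * (\<Sum>n. Q n * cnj w ^ n))"
      by (simp add: H_def mult_ac)
  qed
  ultimately show ?thesis by (simp only:)
qed

section \<open>The kernel in one variable\<close>

text \<open>
  One factor of the \<open>(\<alpha>,\<beta>)\<close>-Poisson kernel, without its normalizing constant.
\<close>
definition disc_kernel :: "complex \<Rightarrow> complex \<Rightarrow> complex \<Rightarrow> complex \<Rightarrow> complex" where
  "disc_kernel a b z \<zeta> = of_real (1 - (norm z)\<^sup>2) powr (a + b + 1) /
     ((1 - z * cnj \<zeta>) powr (a + 1) * (1 - cnj z * \<zeta>) powr (b + 1))"

text \<open>
  The factor by which integration against the kernel at radius \<open>r\<close> multiplies the character \<open>w\<^sup>m\<close>.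
\<close>
definition kernel_multiplier :: "complex \<Rightarrow> complex \<Rightarrow> int \<Rightarrow> real \<Rightarrow> complex" where
  "kernel_multiplier a b m r = of_real (1 - r\<^sup>2) powr (a + b + 1) *
     (\<Sum>n. neg_binomial_coeff (a + 1) n * of_real r ^ n *
        shift_seq m (\<lambda>k. neg_binomial_coeff (b + 1) k * of_real r ^ k) n)"

lemma summable_neg_binomial:
  assumes "norm x < 1"
  shows "summable (\<lambda>n. norm (neg_binomial_coeff z n * x ^ n))"
proof (rule powser_insidea)
  define y where "y = complex_of_real ((1 + norm x) / 2)"
  have y: "norm y = (1 + norm x) / 2" by (simp add: y_def del: of_real_divide of_real_add)
  then show "summable (\<lambda>n. neg_binomial_coeff z n * y ^ n)"
    using neg_binomial_sums[of y z] assms by (auto simp: sums_iff)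
  show "norm x < norm y" using y assms by simp
qed

text \<open>
  On the disc both complex powers are binomial series, which turns the kernel into a product of the
  kind that Parseval's identity handles.
\<close>
lemma disc_kernel_series:
  assumes "0 \<le> r" "r < 1" "norm \<zeta> = 1" "norm \<eta> = 1"
  shows "disc_kernel a b (of_real r * \<zeta>) \<eta> = of_real (1 - r\<^sup>2) powr (a + b + 1) *
    ((\<Sum>n. neg_binomial_coeff (a + 1) n * (of_real r * cnj \<eta>) ^ n * \<zeta> ^ n) *
     (\<Sum>n. neg_binomial_coeff (b + 1) n * (of_real r * \<eta>) ^ n * cnj \<zeta> ^ n))"
proof -
  have "norm (of_real r * cnj \<eta> * \<zeta>) < 1" "norm (of_real r * \<eta> * cnj \<zeta>) < 1"
    using assms by (simp_all add: norm_mult)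
  from neg_binomial_sums[OF this(1), of "a + 1"] neg_binomial_sums[OF this(2), of "b + 1"]
  have "(\<Sum>n. neg_binomial_coeff (a + 1) n * (of_real r * cnj \<eta>) ^ n * \<zeta> ^ n) = (1 - of_real r * \<zeta> * cnj \<eta>) powr (- (a + 1))"
    "(\<Sum>n. neg_binomial_coeff (b + 1) n * (of_real r * \<eta>) ^ n * cnj \<zeta> ^ n) = (1 - cnj (of_real r * \<zeta>) * \<eta>) powr (- (b + 1))"
    by (simp_all add: sums_iff mult_ac power_mult_distrib)
  then show ?thesis
    using assms by (simp only: powr_minus) (simp add: disc_kernel_def norm_mult divide_inverse)
qed

text \<open>
  The absolutely convergent series bound the kernel for fixed \<open>r\<close>. The bound may blow up as \<open>r \<rightarrow> 1\<close>; it
  serves integrability and Fubini's theorem only.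
\<close>
lemma disc_kernel_bounded:
  assumes "0 \<le> r" "r < 1"
  shows "\<exists>K. \<forall>\<zeta> \<eta>. norm \<zeta> = 1 \<longrightarrow> norm \<eta> = 1 \<longrightarrow> norm (disc_kernel a b (of_real r * \<zeta>) \<eta>) \<le> K"
proof -
  define S where "S = (\<lambda>z. \<Sum>n. norm (neg_binomial_coeff z n * of_real r ^ n))"
  have S: "norm (\<Sum>n. neg_binomial_coeff z n * (of_real r * v) ^ n * w ^ n) \<le> S z" if "norm v = 1" "norm w = 1" for z v w
  proof -
    have eq: "norm (neg_binomial_coeff z n * (of_real r * v) ^ n * w ^ n) = norm (neg_binomial_coeff z n * of_real r ^ n)" for n
      using that by (simp add: norm_mult norm_power)
    have "summable (\<lambda>n. norm (neg_binomial_coeff z n * (of_real r * v) ^ n * w ^ n))"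
      unfolding eq by (rule summable_neg_binomial) (use assms in simp)
    from summable_norm[OF this] show ?thesis unfolding eq S_def .
  qed
  have "norm (disc_kernel a b (of_real r * \<zeta>) \<eta>) \<le> norm (of_real (1 - r\<^sup>2) powr (a + b + 1) :: complex) * (S (a + 1) * S (b + 1))"
    if "norm \<zeta> = 1" "norm \<eta> = 1" for \<zeta> \<eta>
    unfolding disc_kernel_series[OF assms that] norm_mult
    using that by (intro mult_left_mono mult_mono' S) auto
  then show ?thesis by blast
qed

lemma disc_kernel_measurable [measurable]:
  assumes [measurable]: "f \<in> borel_measurable M" "g \<in> borel_measurable M"
  shows "(\<lambda>x. disc_kernel a b (f x) (g x)) \<in> borel_measurable M"
proof -
  have [measurable]: "cnj \<in> borel_measurable borel"
    by (intro borel_measurable_continuous_onI continuous_intros)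
  show ?thesis unfolding disc_kernel_def by measurable
qed

text \<open>
  Characters are eigenfunctions of the kernel, because it depends only on \<open>\<zeta>\<close> times the conjugate
  of \<open>\<eta>\<close>. In the series this shows as a common factor \<open>\<eta>\<^sup>m\<close>.
\<close>
lemma disc_kernel_moment:
  assumes r: "0 \<le> r" "r < 1" and \<eta>: "norm \<eta> = 1"
  shows "(LINT \<zeta>|circle_measure. \<zeta> powi m * disc_kernel a b (of_real r * \<zeta>) \<eta>) = \<eta> powi m * kernel_multiplier a b m r"
proof -
  define P where "P = (\<lambda>n. neg_binomial_coeff (a + 1) n * (of_real r * cnj \<eta>) ^ n)"
  define Q where "Q = (\<lambda>n. neg_binomial_coeff (b + 1) n * (of_real r * \<eta>) ^ n)"
  define C where "C = complex_of_real (1 - r\<^sup>2) powr (a + b + 1)"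
  define I where "I = (LINT w|circle_measure. w powi m * ((\<Sum>n. P n * w ^ n) * (\<Sum>n. Q n * cnj w ^ n)))"
  have \<eta>0: "\<eta> \<noteq> 0" using \<eta> by auto
  have inv: "cnj \<eta> = inverse \<eta>" by (rule cnj_eq_inverse[OF \<eta>])
  have "(\<lambda>n. P n * shift_seq m Q n) sums I"
    unfolding I_def P_def Q_def using r \<eta>
    by (intro fourier_product_sums summable_neg_binomial) (simp_all add: norm_mult)
  moreover have "P n * shift_seq m Q n = \<eta> powi m * (neg_binomial_coeff (a + 1) n * of_real r ^ n *
        shift_seq m (\<lambda>k. neg_binomial_coeff (b + 1) k * of_real r ^ k) n)" for n
  proof (cases "0 \<le> int n + m")
    case True
    have "\<eta> ^ nat (int n + m) = \<eta> powi (int n + m)" using True by (simp add: power_int_def)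
    also have "\<dots> = \<eta> ^ n * \<eta> powi m" using \<eta>0 by (simp add: power_int_add)
    finally show ?thesis using True \<eta>0
      by (simp add: P_def Q_def shift_seq_def inv power_mult_distrib field_simps)
  qed (simp add: shift_seq_def)
  ultimately have "(\<lambda>n. \<eta> powi m * (neg_binomial_coeff (a + 1) n * of_real r ^ n *
        shift_seq m (\<lambda>k. neg_binomial_coeff (b + 1) k * of_real r ^ k) n)) sums I" by simp
  then have "(\<lambda>n. neg_binomial_coeff (a + 1) n * of_real r ^ n *
        shift_seq m (\<lambda>k. neg_binomial_coeff (b + 1) k * of_real r ^ k) n) sums (I / \<eta> powi m)"
    using sums_mult_D \<eta>0 by fastforce
  then have I: "I = \<eta> powi m * (\<Sum>n. neg_binomial_coeff (a + 1) n * of_real r ^ n *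
        shift_seq m (\<lambda>k. neg_binomial_coeff (b + 1) k * of_real r ^ k) n)"
    using \<eta>0 by (simp add: sums_iff)
  have "(LINT \<zeta>|circle_measure. \<zeta> powi m * disc_kernel a b (of_real r * \<zeta>) \<eta>) =
     (LINT w|circle_measure. C * (w powi m * ((\<Sum>n. P n * w ^ n) * (\<Sum>n. Q n * cnj w ^ n))))"
    by (rule Bochner_Integration.integral_cong[OF refl])
      (simp add: space_circle_measure disc_kernel_series[OF r _ \<eta>] P_def Q_def C_def)
  also have "\<dots> = C * I" unfolding I_def by (rule integral_mult_right_zero)
  finally show ?thesis by (simp add: I C_def kernel_multiplier_def)
qed

text \<open>
  The limit does not depend on \<open>m\<close>, as a shift of the index does not change the leading asymptotics of
  the coefficients.
\<close>
lemma kernel_multiplier_tendsto: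
  assumes s: "Re (a + b) > -1"
  shows "(kernel_multiplier a b m \<longlongrightarrow> rGamma (a + 1) * rGamma (b + 1) * Gamma (a + b + 1)) (at_left 1)"
proof -
  define A where "A = (\<lambda>n. neg_binomial_coeff (a + 1) n * shift_seq m (neg_binomial_coeff (b + 1)) n)"
  define F where "F = (\<lambda>x. of_real (1 - x) powr (a + b + 1) * (\<Sum>n. A n * of_real x ^ n))"
  have s': "Re (a + b + 1) > 0" using s by simp
  have "(\<lambda>n. (neg_binomial_coeff (a + 1) n / npow (a + 1 - 1) n) * (shift_seq m (neg_binomial_coeff (b + 1)) n / npow (b + 1 - 1) n))
     \<longlonglongrightarrow> rGamma (a + 1) * rGamma (b + 1)"
    by (intro tendsto_mult shift_seq_asymp neg_binomial_coeff_asymp)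
  then have A: "(\<lambda>n. A n / npow (a + b + 1 - 1) n) \<longlonglongrightarrow> rGamma (a + 1) * rGamma (b + 1)"
    by (simp add: A_def npow_add)
  have "(F \<longlongrightarrow> rGamma (a + 1) * rGamma (b + 1) * Gamma (a + b + 1)) (at_left 1)"
    unfolding F_def by (rule abel_asymptotic[OF s' A])
  moreover have "filterlim (\<lambda>r::real. r\<^sup>2) (at_left 1) (at_left 1)"
    by real_asymp
  ultimately have "((\<lambda>r. F (r\<^sup>2)) \<longlongrightarrow> rGamma (a + 1) * rGamma (b + 1) * Gamma (a + b + 1)) (at_left 1)"
    by (rule filterlim_compose)
  moreover have "((\<lambda>r. complex_of_real r powi m) \<longlongrightarrow> of_real 1 powi m) (at_left 1)"
    by (intro tendsto_intros) auto
  ultimately have "((\<lambda>r. of_real r powi m * F (r\<^sup>2)) \<longlongrightarrow> of_real 1 powi m * (rGamma (a + 1) * rGamma (b + 1) * Gamma (a + b + 1))) (at_left 1)"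
    by (intro tendsto_mult)
  moreover have "\<forall>\<^sub>F r in at_left (1::real). 0 < r \<and> r < 1"
    using eventually_at_left_real[of 0 1] by simp
  then have "\<forall>\<^sub>F r in at_left 1. of_real r powi m * F (r\<^sup>2) = kernel_multiplier a b m r"
  proof eventually_elim
    case (elim r)
    \<comment> \<open>The shift contributes the factor \<open>r\<^sup>m\<close>, which tends to \<open>1\<close>; what remains is a series in \<open>r\<^sup>2\<close>.\<close>
    have "neg_binomial_coeff (a + 1) n * of_real r ^ n *
        shift_seq m (\<lambda>k. neg_binomial_coeff (b + 1) k * of_real r ^ k) n = of_real r powi m * (A n * of_real (r\<^sup>2) ^ n)" for n
    proof (cases "0 \<le> int n + m")
      case True
      have "complex_of_real r ^ nat (int n + m) = of_real r powi (int n + m)" using True by (simp add: power_int_def)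
      also have "\<dots> = of_real r ^ n * of_real r powi m" using elim by (simp add: power_int_add)
      finally show ?thesis using True
        by (simp add: A_def shift_seq_def power2_eq_square power_mult_distrib mult_ac)
    qed (simp add: A_def shift_seq_def)
    moreover have "r\<^sup>2 < 1" using elim by (simp add: power_less_one_iff)
    then have "summable (\<lambda>n. A n * of_real (r\<^sup>2) ^ n)"
      by (intro summable_norm_cancel[OF asymp_summable[OF s' A]]) (simp del: of_real_power)
    ultimately show ?case
      by (simp only: kernel_multiplier_def F_def suminf_mult) (simp add: mult_ac)
  qed
  ultimately show ?thesis by (simp add: tendsto_cong)
qed

text \<open>
  The normalizing constant is the inverse of the limit just computed. The exclusion of the
  negative integers as values of \<open>a\<close> and \<open>b\<close> enters here: otherwise the limit would vanish.
\<close>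
lemma poisson_const_kernel_multiplier_tendsto:
  assumes "Re a + Re b > -1" "\<And>k::nat. k \<ge> 1 \<Longrightarrow> a \<noteq> - of_nat k" "\<And>k::nat. k \<ge> 1 \<Longrightarrow> b \<noteq> - of_nat k"
  shows "((\<lambda>r. poisson_const a b * kernel_multiplier a b m r) \<longlongrightarrow> 1) (at_left 1)"
proof -
  have nz: "Gamma (c + 1) \<noteq> 0" if "\<And>k::nat. k \<ge> 1 \<Longrightarrow> c \<noteq> - of_nat k" for c :: complex
  proof
    assume "Gamma (c + 1) = 0"
    then obtain n where "c + 1 = - of_nat n"
      by (auto simp: Gamma_eq_zero_iff elim!: nonpos_Ints_cases')
    then have "c = - of_nat n - 1" by (metis add_diff_cancel_right')
    then have "c = - of_nat (Suc n)" by simp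
    then show False using that[of "Suc n"] by simp
  qed
  have nz3: "Gamma (a + b + 1) \<noteq> 0"
    using assms(1) by (subst Gamma_eq_zero_iff) (auto elim!: nonpos_Ints_cases dest: arg_cong[where f = Re])
  have "((\<lambda>r. poisson_const a b * kernel_multiplier a b m r) \<longlongrightarrow>
     poisson_const a b * (rGamma (a + 1) * rGamma (b + 1) * Gamma (a + b + 1))) (at_left 1)"
    by (intro tendsto_intros kernel_multiplier_tendsto) (use assms(1) in simp)
  moreover have "poisson_const a b * (rGamma (a + 1) * rGamma (b + 1) * Gamma (a + b + 1)) = 1"
    using nz[OF assms(2)] nz[OF assms(3)] nz3 by (simp add: poisson_const_def rGamma_inverse_Gamma field_simps)
  ultimately show ?thesis by (simp only:)
qed

text \<open>
  Replacing both exponents by the mean of their real parts gives a kernel of comparable size that is positive and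
  symmetric in its arguments; its integral is then again an instance of the moment formula.
\<close>
definition kernel_mean_exponent :: "complex \<Rightarrow> complex \<Rightarrow> complex" where
  "kernel_mean_exponent a b = of_real ((Re a + Re b) / 2)"

text \<open>
  The modulus of \<open>v\<^sup>a\<close> differs from \<open>|v|\<^bsup>Re a\<^esup>\<close> by the exponential of \<open>- Im a\<close> times the argument
  of \<open>v\<close>, and arguments are bounded by \<open>\<pi>\<close>. The powers of \<open>|v|\<close> in the denominator depend only on
  \<open>Re a + Re b\<close>.
\<close>
lemma disc_kernel_dominated:
  assumes "norm z < 1" "norm \<zeta> = 1"
  shows "norm (disc_kernel a b z \<zeta>) \<le> exp (pi * (\<bar>Im a\<bar> + \<bar>Im b\<bar>)) *
     norm (disc_kernel (kernel_mean_exponent a b) (kernel_mean_exponent a b) z \<zeta>)"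
proof -
  define t where "t = kernel_mean_exponent a b"
  define v where "v = 1 - z * cnj \<zeta>"
  have nv: "norm (z * cnj \<zeta>) < 1" using assms by (simp add: norm_mult)
  then have Rev: "Re v > 0" using abs_Re_le_cmod[of "z * cnj \<zeta>"] unfolding v_def by simp
  then have v: "v \<noteq> 0" "v \<notin> \<real>\<^sub>\<le>\<^sub>0" by (auto simp: complex_nonpos_Reals_iff)
  have cv: "1 - cnj z * \<zeta> = cnj v" by (simp add: v_def)
  have Lc: "Ln (cnj v) = cnj (Ln v)" using cnj_Ln[OF v(2)] by simp
  define \<theta> where "\<theta> = Im (Ln v)"
  have \<theta>: "\<bar>\<theta>\<bar> \<le> pi" using mpi_less_Im_Ln[OF v(1)] Im_Ln_le_pi[OF v(1)] by (simp add: \<theta>_def)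
  have num: "norm (of_real (1 - (norm z)\<^sup>2) powr (x + y + 1) :: complex) = (1 - (norm z)\<^sup>2) powr (Re x + Re y + 1)" for x y
    using assms by (subst norm_powr_real_powr) (auto simp: power_le_one)
  have den: "norm (v powr (x + 1) * cnj v powr (y + 1)) = exp ((Re x + Re y + 2) * Re (Ln v)) * exp ((Im y - Im x) * \<theta>)" for x y
    using v by (simp add: powr_def norm_mult Lc \<theta>_def algebra_simps flip: exp_add)
  then have eq: "norm (disc_kernel x y z \<zeta>) = (1 - (norm z)\<^sup>2) powr (Re x + Re y + 1) / exp ((Re x + Re y + 2) * Re (Ln v)) * exp ((Im x - Im y) * \<theta>)" for x y
  proof -
    have "exp ((Im x - Im y) * \<theta>) = inverse (exp ((Im y - Im x) * \<theta>))"
      by (simp add: algebra_simps flip: exp_minus)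
    then show ?thesis
      unfolding disc_kernel_def cv v_def[symmetric] norm_divide num den by (simp add: divide_inverse)
  qed
  have "Re t + Re t = Re a + Re b" "Im t = 0" by (simp_all add: t_def kernel_mean_exponent_def)
  with eq[of t t] have eqt: "norm (disc_kernel t t z \<zeta>) = (1 - (norm z)\<^sup>2) powr (Re a + Re b + 1) / exp ((Re a + Re b + 2) * Re (Ln v))"
    by simp
  have "(Im a - Im b) * \<theta> \<le> \<bar>Im a - Im b\<bar> * \<bar>\<theta>\<bar>" by (metis abs_ge_self abs_mult)
  also have "\<dots> \<le> (\<bar>Im a\<bar> + \<bar>Im b\<bar>) * pi" by (intro mult_mono \<theta>) auto
  finally have "exp ((Im a - Im b) * \<theta>) \<le> exp (pi * (\<bar>Im a\<bar> + \<bar>Im b\<bar>))" by (simp add: mult.commute)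
  then have "norm (disc_kernel t t z \<zeta>) * exp ((Im a - Im b) * \<theta>) \<le> norm (disc_kernel t t z \<zeta>) * exp (pi * (\<bar>Im a\<bar> + \<bar>Im b\<bar>))"
    by (rule mult_left_mono) simp
  then show ?thesis by (simp only: eq[of a b] eqt t_def[symmetric] mult.commute)
qed

lemma disc_kernel_mean_real:
  assumes "norm z < 1" "norm \<zeta> = 1"
  shows "disc_kernel (of_real t) (of_real t) z \<zeta> = of_real (norm (disc_kernel (of_real t) (of_real t) z \<zeta>))"
proof -
  define v where "v = 1 - z * cnj \<zeta>"
  have nv: "norm (z * cnj \<zeta>) < 1" using assms by (simp add: norm_mult)
  then have Rev: "Re v > 0" using abs_Re_le_cmod[of "z * cnj \<zeta>"] unfolding v_def by simp
  have cv: "1 - cnj z * \<zeta> = cnj v" by (simp add: v_def)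
  have "cnj v powr (of_real t + 1) = cnj (v powr (of_real t + 1))"
    using Rev by (subst cnj_powr) auto
  then have "v powr (of_real t + 1) * cnj v powr (of_real t + 1) = of_real ((norm (v powr (of_real t + 1)))\<^sup>2)"
    by (simp only: complex_norm_square)
  moreover have "(of_real (1 - (norm z)\<^sup>2) powr (of_real t + of_real t + 1) :: complex) = of_real ((1 - (norm z)\<^sup>2) powr (t + t + 1))"
    using powr_of_real[of "1 - (norm z)\<^sup>2" "t + t + 1"] assms by (simp add: power_le_one)
  ultimately have "disc_kernel (of_real t) (of_real t) z \<zeta> = of_real ((1 - (norm z)\<^sup>2) powr (t + t + 1) / (norm (v powr (of_real t + 1)))\<^sup>2)"
    unfolding disc_kernel_def cv v_def[symmetric] by simp
  then show ?thesis by (simp del: of_real_divide of_real_power)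
qed

lemma disc_kernel_integrable:
  assumes "0 \<le> r" "r < 1" "norm \<zeta> = 1"
  shows "integrable circle_measure (\<lambda>\<eta>. disc_kernel a b (of_real r * \<zeta>) \<eta>)"
    and "integrable circle_measure (\<lambda>\<eta>. \<eta> powi m * disc_kernel a b (of_real r * \<eta>) \<zeta>)"
proof -
  interpret prob_space circle_measure by (rule prob_space_circle_measure)
  obtain K where K: "\<And>\<zeta> \<eta>. norm \<zeta> = 1 \<Longrightarrow> norm \<eta> = 1 \<Longrightarrow> norm (disc_kernel a b (of_real r * \<zeta>) \<eta>) \<le> K"
    using disc_kernel_bounded[OF assms(1,2)] by blast
  show "integrable circle_measure (\<lambda>\<eta>. disc_kernel a b (of_real r * \<zeta>) \<eta>)"
    by (rule integrable_const_bound[where B = K])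
      (use assms(3) in \<open>auto intro!: AE_I2 K borel_measurable_circleI simp: space_circle_measure\<close>)
  show "integrable circle_measure (\<lambda>\<eta>. \<eta> powi m * disc_kernel a b (of_real r * \<eta>) \<zeta>)"
    by (rule integrable_const_bound[where B = K])
      (use assms(3) in \<open>auto intro!: AE_I2 K borel_measurable_circleI simp: space_circle_measure norm_mult norm_power_int\<close>)
qed

definition kernel_L1_bound :: "complex \<Rightarrow> complex \<Rightarrow> real \<Rightarrow> real" where
  "kernel_L1_bound a b r = exp (pi * (\<bar>Im a\<bar> + \<bar>Im b\<bar>)) *
     norm (kernel_multiplier (kernel_mean_exponent a b) (kernel_mean_exponent a b) 0 r)"

text \<open>
  Since the dominating kernel is positive, its \<open>L\<^sup>1\<close> norm is its integral, that is, its multiplier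
  for the constant character; the convergence of this multiplier as \<open>r \<rightarrow> 1\<close> makes the norms bounded.
\<close>
lemma disc_kernel_L1:
  assumes r: "0 \<le> r" "r < 1" and \<zeta>: "norm \<zeta> = 1"
  shows "(LINT \<eta>|circle_measure. norm (disc_kernel a b (of_real r * \<zeta>) \<eta>)) \<le> kernel_L1_bound a b r"
proof -
  interpret prob_space circle_measure by (rule prob_space_circle_measure)
  define t where "t = kernel_mean_exponent a b"
  define C where "C = exp (pi * (\<bar>Im a\<bar> + \<bar>Im b\<bar>))"
  have nz: "norm (of_real r * \<zeta>) < 1" using r \<zeta> by (simp add: norm_mult)
  have sym: "disc_kernel t t (of_real r * \<zeta>) \<eta> = disc_kernel t t (of_real r * \<eta>) \<zeta>" if "norm \<eta> = 1" for \<eta>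
    using \<zeta> that by (simp add: disc_kernel_def norm_mult mult_ac)
  have "of_real (LINT \<eta>|circle_measure. norm (disc_kernel t t (of_real r * \<zeta>) \<eta>)) =
     (LINT \<eta>|circle_measure. complex_of_real (norm (disc_kernel t t (of_real r * \<zeta>) \<eta>)))"
    by simp
  also have "\<dots> = (LINT \<eta>|circle_measure. \<eta> powi 0 * disc_kernel t t (of_real r * \<eta>) \<zeta>)"
  proof (rule Bochner_Integration.integral_cong[OF refl])
    fix \<eta> assume "\<eta> \<in> space circle_measure"
    then have "norm \<eta> = 1" by (simp add: space_circle_measure)
    then show "complex_of_real (norm (disc_kernel t t (of_real r * \<zeta>) \<eta>)) = \<eta> powi 0 * disc_kernel t t (of_real r * \<eta>) \<zeta>"
      using disc_kernel_mean_real[OF nz, of \<eta> "(Re a + Re b) / 2"] sym[of \<eta>]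
      unfolding t_def kernel_mean_exponent_def by (metis mult_1 power_int_0_right)
  qed
  also have "\<dots> = kernel_multiplier t t 0 r"
    using disc_kernel_moment[OF r \<zeta>, of 0 t t] by simp
  finally have "norm (complex_of_real (LINT \<eta>|circle_measure. norm (disc_kernel t t (of_real r * \<zeta>) \<eta>))) = norm (kernel_multiplier t t 0 r)"
    by (rule arg_cong)
  then have eq: "(LINT \<eta>|circle_measure. norm (disc_kernel t t (of_real r * \<zeta>) \<eta>)) = norm (kernel_multiplier t t 0 r)"
    by (simp only: norm_of_real) simp
  have "(LINT \<eta>|circle_measure. norm (disc_kernel a b (of_real r * \<zeta>) \<eta>)) \<le> (LINT \<eta>|circle_measure. C * norm (disc_kernel t t (of_real r * \<zeta>) \<eta>))"
    using disc_kernel_dominated[OF nz, of _ a b]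
    by (intro integral_mono integrable_norm integrable_mult_right disc_kernel_integrable r \<zeta>)
      (auto simp: C_def t_def space_circle_measure)
  also have "\<dots> = C * norm (kernel_multiplier t t 0 r)" by (simp add: eq)
  finally show ?thesis by (simp add: kernel_L1_bound_def C_def t_def)
qed

lemma kernel_L1_bound_tendsto:
  assumes "Re a + Re b > -1"
  shows "\<exists>L. (kernel_L1_bound a b \<longlongrightarrow> L) (at_left 1)"
proof -
  have "Re (kernel_mean_exponent a b + kernel_mean_exponent a b) > -1"
    using assms by (simp add: kernel_mean_exponent_def)
  from tendsto_mult[OF tendsto_const tendsto_norm[OF kernel_multiplier_tendsto[OF this, of 0]]] show ?thesis
    unfolding kernel_L1_bound_def by (rule exI)
qed

section \<open>The kernel on the torus\<close>
lemma sets_torus_measure: "sets torus_measure = sets (restrict_space borel torus)"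
  by (simp add: torus_measure_def)

lemma space_torus_measure: "space torus_measure = torus"
  by (simp add: torus_measure_def space_restrict_space)

lemma borel_measurable_torusI: "f \<in> borel_measurable borel \<Longrightarrow> f \<in> borel_measurable torus_measure"
  unfolding measurable_cong_sets[OF sets_torus_measure refl] by (rule measurable_restrict_space1)

lemma measurable_vec_lambda_torus:
  "vec_lambda \<in> Pi\<^sub>M UNIV (\<lambda>_::'n::finite. circle_measure) \<rightarrow>\<^sub>M restrict_space borel torus"
proof (rule measurable_restrict_space2)
  let ?N = "Pi\<^sub>M UNIV (\<lambda>_::'n. circle_measure)"
  show "vec_lambda \<in> space ?N \<rightarrow> (torus :: (complex ^ 'n) set)"
    by (auto simp: torus_def space_PiM space_circle_measure PiE_def)
  have comp: "(\<lambda>x. x i) \<in> borel_measurable ?N" for i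
  proof -
    have "(\<lambda>x. x i) \<in> ?N \<rightarrow>\<^sub>M circle_measure" by measurable
    from measurable_compose[OF this, of "\<lambda>w. w" borel] show ?thesis
      by (simp add: borel_measurable_circleI)
  qed
  show "vec_lambda \<in> ?N \<rightarrow>\<^sub>M (borel :: (complex ^ 'n) measure)"
  proof (rule borel_measurable_euclidean_space[THEN iffD2], rule ballI)
    fix b :: "complex ^ 'n" assume "b \<in> Basis"
    then obtain i c where b: "b = axis i c" by (auto simp: Basis_vec_def)
    have "(\<lambda>x. x i \<bullet> c) \<in> borel_measurable ?N"
      by (intro borel_measurable_inner comp borel_measurable_const)
    then show "(\<lambda>x. vec_lambda x \<bullet> b) \<in> borel_measurable ?N"
      by (simp add: b inner_axis)
  qed
qed

lemma measurable_torus_component: "(\<lambda>\<zeta>::complex ^ 'n. \<zeta> $ j) \<in> torus_measure \<rightarrow>\<^sub>M circle_measure"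
proof -
  have "(\<lambda>\<zeta>::complex ^ 'n. \<zeta> $ j) \<in> torus_measure \<rightarrow>\<^sub>M restrict_space borel (sphere 0 1)"
  proof (rule measurable_restrict_space2)
    show "(\<lambda>\<zeta>::complex ^ 'n. \<zeta> $ j) \<in> borel_measurable torus_measure"
      by (intro borel_measurable_torusI borel_measurable_continuous_onI continuous_intros)
  qed (auto simp: space_torus_measure torus_def)
  then show ?thesis by (simp add: measurable_cong_sets[OF refl sets_circle_measure])
qed

lemma prob_space_torus_measure: "prob_space (torus_measure :: (complex ^ 'n::finite) measure)"
proof -
  interpret P: prob_space "Pi\<^sub>M UNIV (\<lambda>_::'n. circle_measure)"
    by (rule prob_space_PiM) (rule prob_space_circle_measure)
  show ?thesis unfolding torus_measure_def
    by (rule P.prob_space_distr) (rule measurable_vec_lambda_torus)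
qed

lemma torus_integral_prod:
  fixes g :: "'n::finite \<Rightarrow> complex \<Rightarrow> 'b::{real_normed_field, banach, second_countable_topology}"
  assumes g: "\<And>j. integrable circle_measure (g j)"
  shows "(LINT \<zeta>|torus_measure. (\<Prod>j\<in>UNIV. g j (\<zeta> $ j))) = (\<Prod>j\<in>UNIV. (LINT w|circle_measure. g j w))"
proof -
  interpret product_sigma_finite "\<lambda>_::'n. circle_measure"
    unfolding product_sigma_finite_def
    using prob_space_imp_sigma_finite[OF prob_space_circle_measure] by blast
  have meas: "(\<lambda>\<zeta>. (\<Prod>j\<in>UNIV. g j (\<zeta> $ j))) \<in> borel_measurable (torus_measure :: (complex ^ 'n) measure)"
    by (intro borel_measurable_prod measurable_compose[OF measurable_torus_component borel_measurable_integrable[OF g]])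
  have "(LINT \<zeta>|(torus_measure :: (complex ^ 'n) measure). (\<Prod>j\<in>UNIV. g j (\<zeta> $ j))) =
    (LINT x|Pi\<^sub>M UNIV (\<lambda>_::'n. circle_measure). (\<Prod>j\<in>UNIV. g j (x j)))"
    using meas[unfolded measurable_cong_sets[OF sets_torus_measure refl]]
    unfolding torus_measure_def by (subst integral_distr[OF measurable_vec_lambda_torus]) simp_all
  also have "\<dots> = (\<Prod>j\<in>UNIV. (LINT w|circle_measure. g j w))"
    by (rule product_integral_prod) (simp_all add: g)
  finally show ?thesis .
qed

definition radial :: "real ^ 'n \<Rightarrow> complex ^ 'n \<Rightarrow> complex ^ 'n" where
  "radial r \<zeta> = (\<chi> j. complex_of_real (r $ j) * \<zeta> $ j)"

definition monomial :: "('n::finite \<Rightarrow> int) \<Rightarrow> complex ^ 'n \<Rightarrow> complex" where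
  "monomial m \<zeta> = (\<Prod>j\<in>UNIV. \<zeta> $ j powi m j)"

lemma norm_monomial: "\<zeta> \<in> torus \<Longrightarrow> norm (monomial m \<zeta>) = 1"
  by (simp add: monomial_def torus_def norm_power_int prod_norm[symmetric])

lemma monomial_measurable [measurable]: "monomial m \<in> borel_measurable borel"
proof -
  have [measurable]: "(\<lambda>\<zeta>::complex ^ 'n. \<zeta> $ j) \<in> borel_measurable borel" for j
    by (intro borel_measurable_continuous_onI continuous_intros)
  show ?thesis unfolding monomial_def by measurable
qed

lemma poisson_kernel_radial:
  "poisson_kernel \<alpha> \<beta> (radial r \<zeta>) \<eta> =
    (\<Prod>j\<in>UNIV. poisson_const (\<alpha> $ j) (\<beta> $ j) * disc_kernel (\<alpha> $ j) (\<beta> $ j) (of_real (r $ j) * \<zeta> $ j) (\<eta> $ j))"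
  by (simp add: poisson_kernel_def radial_def disc_kernel_def)

lemma poisson_kernel_measurable:
  "(\<lambda>p. poisson_kernel \<alpha> \<beta> (radial r (fst p)) (snd p)) \<in> borel_measurable (torus_measure \<Otimes>\<^sub>M torus_measure)"
proof -
  have [measurable]: "(\<lambda>\<zeta>::complex ^ 'n. \<zeta> $ j) \<in> borel_measurable torus_measure" for j
    by (intro borel_measurable_torusI borel_measurable_continuous_onI continuous_intros)
  show ?thesis unfolding poisson_kernel_radial by measurable
qed

lemma poisson_kernel_bounded:
  fixes \<alpha> \<beta> :: "complex ^ 'n"
  assumes r: "\<And>j. 0 \<le> r $ j \<and> r $ j < 1"
  shows "\<exists>K. \<forall>\<zeta>\<in>torus. \<forall>\<eta>\<in>torus. norm (poisson_kernel \<alpha> \<beta> (radial r \<zeta>) \<eta>) \<le> K"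
proof -
  have "\<forall>j. \<exists>K. \<forall>\<zeta> \<eta>. norm \<zeta> = 1 \<longrightarrow> norm \<eta> = 1 \<longrightarrow> norm (disc_kernel (\<alpha> $ j) (\<beta> $ j) (of_real (r $ j) * \<zeta>) \<eta>) \<le> K"
    using disc_kernel_bounded r by blast
  then obtain K where K: "\<And>j \<zeta> \<eta>. norm \<zeta> = 1 \<Longrightarrow> norm \<eta> = 1 \<Longrightarrow> norm (disc_kernel (\<alpha> $ j) (\<beta> $ j) (of_real (r $ j) * \<zeta>) \<eta>) \<le> K j"
    by metis
  have "norm (poisson_kernel \<alpha> \<beta> (radial r \<zeta>) \<eta>) \<le> (\<Prod>j\<in>UNIV. norm (poisson_const (\<alpha> $ j) (\<beta> $ j)) * K j)"
    if "\<zeta> \<in> torus" "\<eta> \<in> torus" for \<zeta> \<eta>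
    unfolding poisson_kernel_radial prod_norm[symmetric] norm_mult
    using that by (intro prod_mono conjI mult_left_mono mult_nonneg_nonneg)
       (auto simp: torus_def norm_mult intro!: K[unfolded norm_mult])
  then show ?thesis by blast
qed

lemma poisson_kernel_moment:
  fixes \<alpha> \<beta> :: "complex ^ 'n"
  assumes r: "\<And>j. 0 \<le> r $ j \<and> r $ j < 1" and \<eta>: "\<eta> \<in> torus"
  shows "(LINT \<zeta>|torus_measure. monomial m \<zeta> * poisson_kernel \<alpha> \<beta> (radial r \<zeta>) \<eta>) =
    (\<Prod>j\<in>UNIV. poisson_const (\<alpha> $ j) (\<beta> $ j) * kernel_multiplier (\<alpha> $ j) (\<beta> $ j) (m j) (r $ j)) * monomial m \<eta>"
proof -
  have \<eta>j: "norm (\<eta> $ j) = 1" for j using \<eta> by (simp add: torus_def)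
  let ?g = "\<lambda>j w. poisson_const (\<alpha> $ j) (\<beta> $ j) * (w powi m j * disc_kernel (\<alpha> $ j) (\<beta> $ j) (of_real (r $ j) * w) (\<eta> $ j))"
  have "(LINT \<zeta>|torus_measure. monomial m \<zeta> * poisson_kernel \<alpha> \<beta> (radial r \<zeta>) \<eta>) =
    (LINT \<zeta>|torus_measure. (\<Prod>j\<in>UNIV. ?g j (\<zeta> $ j)))"
    unfolding poisson_kernel_radial monomial_def prod.distrib[symmetric] by (simp add: mult_ac)
  also have "\<dots> = (\<Prod>j\<in>UNIV. (LINT w|circle_measure. ?g j w))"
    using r \<eta>j by (intro torus_integral_prod integrable_mult_right disc_kernel_integrable) auto
  also have "\<dots> = (\<Prod>j\<in>UNIV. poisson_const (\<alpha> $ j) (\<beta> $ j) * kernel_multiplier (\<alpha> $ j) (\<beta> $ j) (m j) (r $ j) * (\<eta> $ j powi m j))"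
  proof (rule prod.cong[OF refl])
    fix j
    have "(LINT w|circle_measure. ?g j w) = poisson_const (\<alpha> $ j) (\<beta> $ j) * (\<eta> $ j powi m j * kernel_multiplier (\<alpha> $ j) (\<beta> $ j) (m j) (r $ j))"
      using r \<eta>j by (subst disc_kernel_moment[symmetric]) auto
    then show "(LINT w|circle_measure. ?g j w) = poisson_const (\<alpha> $ j) (\<beta> $ j) * kernel_multiplier (\<alpha> $ j) (\<beta> $ j) (m j) (r $ j) * (\<eta> $ j powi m j)"
      by (simp add: mult_ac)
  qed
  finally show ?thesis by (simp add: prod.distrib monomial_def)
qed

definition poisson_L1_bound :: "complex ^ 'n \<Rightarrow> complex ^ 'n \<Rightarrow> real ^ 'n \<Rightarrow> real" where
  "poisson_L1_bound \<alpha> \<beta> r = (\<Prod>j\<in>UNIV. norm (poisson_const (\<alpha> $ j) (\<beta> $ j)) * kernel_L1_bound (\<alpha> $ j) (\<beta> $ j) (r $ j))"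

lemma poisson_kernel_L1:
  fixes \<alpha> \<beta> :: "complex ^ 'n"
  assumes r: "\<And>j. 0 \<le> r $ j \<and> r $ j < 1" and \<zeta>: "\<zeta> \<in> torus"
  shows "(LINT \<eta>|torus_measure. norm (poisson_kernel \<alpha> \<beta> (radial r \<zeta>) \<eta>)) \<le> poisson_L1_bound \<alpha> \<beta> r"
proof -
  have \<zeta>j: "norm (\<zeta> $ j) = 1" for j using \<zeta> by (simp add: torus_def)
  let ?g = "\<lambda>j w. norm (poisson_const (\<alpha> $ j) (\<beta> $ j)) * norm (disc_kernel (\<alpha> $ j) (\<beta> $ j) (of_real (r $ j) * \<zeta> $ j) w)"
  have "(LINT \<eta>|torus_measure. norm (poisson_kernel \<alpha> \<beta> (radial r \<zeta>) \<eta>)) = (LINT \<eta>|torus_measure. (\<Prod>j\<in>UNIV. ?g j (\<eta> $ j)))"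
    unfolding poisson_kernel_radial prod_norm[symmetric] norm_mult ..
  also have "\<dots> = (\<Prod>j\<in>UNIV. (LINT w|circle_measure. ?g j w))"
    using r \<zeta>j by (intro torus_integral_prod integrable_mult_right integrable_norm disc_kernel_integrable) auto
  also have "\<dots> \<le> poisson_L1_bound \<alpha> \<beta> r"
    unfolding poisson_L1_bound_def integral_mult_right_zero
    using r \<zeta>j by (intro prod_mono conjI mult_left_mono disc_kernel_L1 mult_nonneg_nonneg integral_nonneg_AE) auto
  finally show ?thesis .
qed

section \<open>Weak star null nets and test functions\<close>

text \<open>
  A net that is eventually bounded in \<open>L\<^sup>\<infinity>\<close>. For such a net the test functions on which it
  converges to zero form a closed subspace of \<open>L\<^sup>1\<close>, so that it suffices to test a set with dense
  span. The bound is uniform in the points, not merely essential, which spares null sets.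
\<close>
locale bounded_net = finite_measure M for M :: "'a measure" +
  fixes h :: "'r \<Rightarrow> 'a \<Rightarrow> complex" and G :: "'r filter" and B :: real
  assumes measurable_bounded: "\<forall>\<^sub>F r in G. h r \<in> borel_measurable M \<and> (\<forall>x\<in>space M. norm (h r x) \<le> B)"
begin

definition null_tests :: "('a \<Rightarrow> complex) set" where
  "null_tests = {\<phi>. integrable M \<phi> \<and> ((\<lambda>r. LINT x|M. \<phi> x * h r x) \<longlongrightarrow> 0) G}"

lemma null_tests_integrable: "\<phi> \<in> null_tests \<Longrightarrow> integrable M \<phi>"
  by (simp add: null_tests_def)

lemma integrable_mult_net:
  assumes "integrable M \<phi>" "h r \<in> borel_measurable M" "\<forall>x\<in>space M. norm (h r x) \<le> B"
  shows "integrable M (\<lambda>x. \<phi> x * h r x)"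
proof (rule Bochner_Integration.integrable_bound)
  show "integrable M (\<lambda>x. B * norm (\<phi> x))" using assms(1) by simp
  show "(\<lambda>x. \<phi> x * h r x) \<in> borel_measurable M"
    using borel_measurable_integrable[OF assms(1)] assms(2) by simp
  show "AE x in M. norm (\<phi> x * h r x) \<le> norm (B * norm (\<phi> x))"
  proof (rule AE_I2)
    fix x assume "x \<in> space M"
    then have "norm (h r x) * norm (\<phi> x) \<le> B * norm (\<phi> x)"
      using assms(3) by (intro mult_right_mono) auto
    then show "norm (\<phi> x * h r x) \<le> norm (B * norm (\<phi> x))" by (simp add: norm_mult mult.commute)
  qed
qed

lemma null_tests_cong:
  assumes "\<phi> \<in> null_tests" "\<And>x. x \<in> space M \<Longrightarrow> \<phi> x = \<psi> x"
  shows "\<psi> \<in> null_tests"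
proof -
  have "integrable M \<psi> = integrable M \<phi>"
    by (rule Bochner_Integration.integrable_cong[OF refl]) (simp add: assms(2))
  moreover have "(LINT x|M. \<psi> x * h r x) = (LINT x|M. \<phi> x * h r x)" for r
    by (rule Bochner_Integration.integral_cong[OF refl]) (simp add: assms(2))
  ultimately show ?thesis using assms(1) by (simp add: null_tests_def)
qed

lemma null_tests_add:
  assumes \<phi>: "\<phi> \<in> null_tests" and \<psi>: "\<psi> \<in> null_tests"
  shows "(\<lambda>x. \<phi> x + \<psi> x) \<in> null_tests"
proof -
  have "((\<lambda>r. (LINT x|M. \<phi> x * h r x) + (LINT x|M. \<psi> x * h r x)) \<longlongrightarrow> 0 + 0) G"
    using \<phi> \<psi> by (intro tendsto_add) (auto simp: null_tests_def)
  moreover have "\<forall>\<^sub>F r in G. (LINT x|M. \<phi> x * h r x) + (LINT x|M. \<psi> x * h r x) = (LINT x|M. (\<phi> x + \<psi> x) * h r x)"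
    using measurable_bounded
  proof eventually_elim
    case (elim r)
    then show ?case
      using integrable_mult_net[OF null_tests_integrable[OF \<phi>]] integrable_mult_net[OF null_tests_integrable[OF \<psi>]]
      by (simp add: distrib_right)
  qed
  ultimately show ?thesis using \<phi> \<psi> by (simp add: null_tests_def tendsto_cong)
qed

lemma null_tests_cmult:
  assumes \<phi>: "\<phi> \<in> null_tests"
  shows "(\<lambda>x. c * \<phi> x) \<in> null_tests"
proof -
  have "((\<lambda>r. c * (LINT x|M. \<phi> x * h r x)) \<longlongrightarrow> c * 0) G"
    using \<phi> by (intro tendsto_mult tendsto_const) (auto simp: null_tests_def)
  then show ?thesis using \<phi> by (simp add: null_tests_def mult.assoc)
qed

lemma null_tests_zero: "(\<lambda>x. 0) \<in> null_tests"
  by (simp add: null_tests_def)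

lemma null_tests_sum:
  assumes "finite A" "\<And>i. i \<in> A \<Longrightarrow> \<phi> i \<in> null_tests"
  shows "(\<lambda>x. \<Sum>i\<in>A. \<phi> i x) \<in> null_tests"
  using assms by (induction A rule: finite_induct) (auto simp: null_tests_zero null_tests_add)

lemma null_tests_L1_closed:
  assumes \<phi>: "integrable M \<phi>"
    and approx: "\<And>\<epsilon>. \<epsilon> > 0 \<Longrightarrow> \<exists>\<psi>\<in>null_tests. (LINT x|M. norm (\<phi> x - \<psi> x)) < \<epsilon>"
  shows "\<phi> \<in> null_tests"
proof -
  have "((\<lambda>r. LINT x|M. \<phi> x * h r x) \<longlongrightarrow> 0) G"
  proof (rule tendstoI)
    fix \<epsilon> :: real assume \<epsilon>: "\<epsilon> > 0"
    \<comment> \<open>Adding \<open>1\<close> keeps the denominator positive.\<close>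
    define \<delta> where "\<delta> = \<epsilon> / (2 * (\<bar>B\<bar> + 1))"
    have \<delta>: "\<delta> > 0" using \<epsilon> by (simp add: \<delta>_def)
    obtain \<psi> where \<psi>: "\<psi> \<in> null_tests" and close: "(LINT x|M. norm (\<phi> x - \<psi> x)) < \<delta>"
      using approx[OF \<delta>] by blast
    have int: "integrable M (\<lambda>x. \<phi> x - \<psi> x)" using \<phi> null_tests_integrable[OF \<psi>] by simp
    have "\<forall>\<^sub>F r in G. dist (LINT x|M. \<psi> x * h r x) 0 < \<epsilon> / 2"
      using \<psi> \<epsilon> by (intro tendstoD) (auto simp: null_tests_def)
    with measurable_bounded show "\<forall>\<^sub>F r in G. dist (LINT x|M. \<phi> x * h r x) 0 < \<epsilon>"
    proof eventually_elim
      case (elim r)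
      have i1: "integrable M (\<lambda>x. (\<phi> x - \<psi> x) * h r x)" and i2: "integrable M (\<lambda>x. \<psi> x * h r x)"
        using elim integrable_mult_net[OF int, of r] integrable_mult_net[OF null_tests_integrable[OF \<psi>], of r] by auto
      have "(LINT x|M. \<phi> x * h r x) = (LINT x|M. (\<phi> x - \<psi> x) * h r x + \<psi> x * h r x)"
        by (simp add: algebra_simps)
      also have "\<dots> = (LINT x|M. (\<phi> x - \<psi> x) * h r x) + (LINT x|M. \<psi> x * h r x)"
        by (rule Bochner_Integration.integral_add[OF i1 i2])
      finally have "norm (LINT x|M. \<phi> x * h r x) \<le> norm (LINT x|M. (\<phi> x - \<psi> x) * h r x) + norm (LINT x|M. \<psi> x * h r x)"
        by (simp add: norm_triangle_ineq)
      also have "norm (LINT x|M. (\<phi> x - \<psi> x) * h r x) \<le> (LINT x|M. norm ((\<phi> x - \<psi> x) * h r x))"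
        by (rule integral_norm_bound)
      also have "\<dots> \<le> (LINT x|M. (\<bar>B\<bar> + 1) * norm (\<phi> x - \<psi> x))"
      proof (rule integral_mono)
        show "integrable M (\<lambda>x. norm ((\<phi> x - \<psi> x) * h r x))" using i1 by (rule integrable_norm)
        show "integrable M (\<lambda>x. (\<bar>B\<bar> + 1) * norm (\<phi> x - \<psi> x))" using int by simp
        fix x assume "x \<in> space M"
        then have "norm (h r x) \<le> \<bar>B\<bar> + 1" using elim by force
        then have "norm (h r x) * norm (\<phi> x - \<psi> x) \<le> (\<bar>B\<bar> + 1) * norm (\<phi> x - \<psi> x)"
          by (rule mult_right_mono) simp
        then show "norm ((\<phi> x - \<psi> x) * h r x) \<le> (\<bar>B\<bar> + 1) * norm (\<phi> x - \<psi> x)" by (simp add: norm_mult mult.commute)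
      qed
      also have "\<dots> = (\<bar>B\<bar> + 1) * (LINT x|M. norm (\<phi> x - \<psi> x))" by simp
      also have "\<dots> < (\<bar>B\<bar> + 1) * \<delta>" using close by (intro mult_strict_left_mono) auto
      also have "\<dots> = \<epsilon> / 2" by (simp add: \<delta>_def field_simps)
      finally show ?case using elim by simp
    qed
  qed
  with \<phi> show ?thesis by (simp add: null_tests_def)
qed

lemma null_tests_dominated_limit:
  assumes s: "\<And>i::nat. s i \<in> null_tests" and \<phi>: "\<phi> \<in> borel_measurable M" and w: "integrable M w"
    and lim: "\<And>x. x \<in> space M \<Longrightarrow> (\<lambda>i. s i x) \<longlonglongrightarrow> \<phi> x"
    and dom: "\<And>i x. x \<in> space M \<Longrightarrow> norm (s i x) \<le> w x"
  shows "\<phi> \<in> null_tests"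
proof (rule null_tests_L1_closed)
  have sm: "s i \<in> borel_measurable M" for i by (rule borel_measurable_integrable[OF null_tests_integrable[OF s]])
  show int: "integrable M \<phi>"
    by (rule integrable_dominated_convergence[OF \<phi> sm w]) (auto intro!: AE_I2 lim dom)
  fix \<epsilon> :: real assume \<epsilon>: "\<epsilon> > 0"
  have "(\<lambda>i. LINT x|M. norm (\<phi> x - s i x)) \<longlonglongrightarrow> (LINT x|M. 0)"
  proof (rule integral_dominated_convergence)
    show "integrable M (\<lambda>x. norm (\<phi> x) + w x)" using int w by simp
    show "AE x in M. (\<lambda>i. norm (\<phi> x - s i x)) \<longlonglongrightarrow> 0"
    proof (rule AE_I2)
      fix x assume "x \<in> space M"
      from tendsto_norm[OF tendsto_diff[OF tendsto_const lim[OF this], of "\<phi> x"]]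
      show "(\<lambda>i. norm (\<phi> x - s i x)) \<longlonglongrightarrow> 0" by simp
    qed
    show "AE x in M. norm (norm (\<phi> x - s i x)) \<le> norm (\<phi> x) + w x" for i
    proof (rule AE_I2)
      fix x assume "x \<in> space M"
      from dom[OF this, of i] show "norm (norm (\<phi> x - s i x)) \<le> norm (\<phi> x) + w x"
        using norm_triangle_ineq4[of "\<phi> x" "s i x"] by simp
    qed
  qed (use \<phi> sm in auto)
  then have "\<forall>\<^sub>F i in sequentially. (LINT x|M. norm (\<phi> x - s i x)) < \<epsilon>"
    by (intro order_tendstoD) (use \<epsilon> in auto)
  then obtain i where "(LINT x|M. norm (\<phi> x - s i x)) < \<epsilon>"
    using eventually_sequentially by auto
  then show "\<exists>\<psi>\<in>null_tests. (LINT x|M. norm (\<phi> x - \<psi> x)) < \<epsilon>" using s by blast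
qed

lemma null_tests_uniform_closed:
  assumes \<phi>: "\<phi> \<in> borel_measurable M"
    and approx: "\<And>\<epsilon>. \<epsilon> > 0 \<Longrightarrow> \<exists>\<psi>\<in>null_tests. \<forall>x\<in>space M. norm (\<phi> x - \<psi> x) \<le> \<epsilon>"
  shows "\<phi> \<in> null_tests"
proof -
  have "\<forall>i. \<exists>\<psi>. \<psi> \<in> null_tests \<and> (\<forall>x\<in>space M. norm (\<phi> x - \<psi> x) \<le> 1 / Suc i)"
    using approx by (meson of_nat_0_less_iff zero_less_Suc zero_less_divide_1_iff)
  then obtain s where s: "\<And>i. s i \<in> null_tests" and close: "\<And>i x. x \<in> space M \<Longrightarrow> norm (\<phi> x - s i x) \<le> 1 / Suc i"
    by metis
  show ?thesis
  proof (rule null_tests_dominated_limit[OF s \<phi>])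
    show "integrable M (\<lambda>x. norm (s 0 x) + 2)" using null_tests_integrable[OF s] by simp
    fix x assume x: "x \<in> space M"
    have "(\<lambda>i. \<phi> x - s i x) \<longlonglongrightarrow> 0"
    proof (rule tendsto_norm_zero_cancel, rule tendsto_sandwich[OF _ _ tendsto_const])
      show "(\<lambda>i. 1 / real (Suc i)) \<longlonglongrightarrow> 0" by real_asymp
    qed (auto intro!: always_eventually close x simp del: of_nat_Suc)
    from tendsto_diff[OF tendsto_const this, of "\<phi> x"] show "(\<lambda>i. s i x) \<longlonglongrightarrow> \<phi> x" by simp
    fix i
    have "norm (s i x) = norm (s 0 x + ((\<phi> x - s 0 x) - (\<phi> x - s i x)))" by simp
    also have "\<dots> \<le> norm (s 0 x) + (norm (\<phi> x - s 0 x) + norm (\<phi> x - s i x))"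
      by (meson add_left_mono norm_triangle_ineq norm_triangle_ineq4 order_trans)
    also have "norm (\<phi> x - s 0 x) \<le> 1" using close[OF x, of 0] by simp
    also have "norm (\<phi> x - s i x) \<le> 1" using close[OF x, of i] by (rule order_trans) simp
    finally show "norm (s i x) \<le> norm (s 0 x) + 2" by simp
  qed
qed

text \<open>
  Simple functions are dense in \<open>L\<^sup>1\<close>.
\<close>
lemma null_tests_all:
  assumes ind: "\<And>A. A \<in> sets M \<Longrightarrow> (indicator A :: 'a \<Rightarrow> complex) \<in> null_tests"
    and "integrable M \<phi>"
  shows "\<phi> \<in> null_tests"
  using assms(2)
proof (induction rule: integrable_induct)
  case (base A c)
  from null_tests_cmult[OF ind[OF base(1)], of c] show ?case
    by (rule null_tests_cong) (simp add: indicator_def)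
next
  case (add f g)
  then show ?case by (intro null_tests_add)
next
  case (lim f s)
  show ?case
    by (rule null_tests_dominated_limit[of s f "\<lambda>x. 2 * norm (f x)"]) (use lim in auto)
qed

end

text \<open>
  Continuous test functions suffice: the indicator of a closed set is a decreasing limit of continuous
  functions, and the sets with admissible indicator form a Dynkin system.
\<close>
locale bounded_net_metric = bounded_net M h G B for M :: "'a::metric_space measure" and h :: "'r \<Rightarrow> 'a \<Rightarrow> complex" and G B +
  fixes S :: "'a set"
  assumes sets_M: "sets M = sets (restrict_space borel S)"
    and continuous_null_test: "\<And>g :: 'a \<Rightarrow> real. continuous_on UNIV g \<Longrightarrow> (\<lambda>x. of_real (g x)) \<in> null_tests"
begin

lemma borel_measurable_restrict: "f \<in> borel_measurable borel \<Longrightarrow> f \<in> borel_measurable M"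
  unfolding measurable_cong_sets[OF sets_M refl] by (rule measurable_restrict_space1)

lemma null_tests_closed:
  assumes C: "closed C"
  shows "(indicator C :: 'a \<Rightarrow> complex) \<in> null_tests"
proof (cases "C = {}")
  case True
  show ?thesis by (rule null_tests_cong[OF null_tests_zero]) (simp add: True)
next
  case False
  define s where "s = (\<lambda>(k::nat) x. max 0 (1 - real k * infdist x C))"
  show ?thesis
  proof (rule null_tests_dominated_limit)
    show "(\<lambda>x. of_real (s k x)) \<in> null_tests" for k
      unfolding s_def by (intro continuous_null_test continuous_intros)
    show "(indicator C :: 'a \<Rightarrow> complex) \<in> borel_measurable M"
      using C by (intro borel_measurable_restrict) auto
    show "integrable M (\<lambda>x. 1 :: real)" by simp
    show "norm (complex_of_real (s k x)) \<le> 1" for k x by (simp add: s_def infdist_nonneg)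
    fix x
    have "(\<lambda>k. s k x) \<longlonglongrightarrow> indicator C x"
    proof (cases "x \<in> C")
      case True
      then show ?thesis by (simp add: s_def)
    next
      case x: False
      then have d: "infdist x C > 0"
        using in_closed_iff_infdist_zero[OF C False] infdist_nonneg[of x C] by (metis order_less_le)
      obtain N :: nat where "1 / infdist x C \<le> N" using real_arch_simple by blast
      then have N: "1 \<le> real N * infdist x C" using d by (simp add: field_simps)
      have "s k x = 0" if "k \<ge> N" for k
      proof -
        have "real N * infdist x C \<le> real k * infdist x C" using that d by (intro mult_right_mono) auto
        then show ?thesis using N by (simp add: s_def)
      qed
      then have "\<forall>\<^sub>F k in sequentially. s k x = 0" by (auto simp: eventually_sequentially)
      then show ?thesis using x by (simp add: tendsto_eventually)
    qed
    then have "(\<lambda>k. complex_of_real (s k x)) \<longlonglongrightarrow> of_real (indicator C x)" by (rule tendsto_of_real)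
    then show "(\<lambda>k. complex_of_real (s k x)) \<longlonglongrightarrow> indicator C x" by (simp add: of_real_indicator)
  qed
qed

lemma null_tests_borel:
  assumes "A \<in> sets borel"
  shows "(indicator A :: 'a \<Rightarrow> complex) \<in> null_tests"
proof -
  have borel_sets: "sets borel = sigma_sets UNIV (Collect (closed :: 'a set \<Rightarrow> bool))"
    by (subst borel_eq_closed) (rule sets_measure_of, simp)
  have "Int_stable (Collect (closed :: 'a set \<Rightarrow> bool))" by (auto simp: Int_stable_def)
  moreover have "Collect (closed :: 'a set \<Rightarrow> bool) \<subseteq> Pow UNIV" by simp
  moreover have "A \<in> sigma_sets UNIV (Collect closed)" using assms borel_sets by simp
  ultimately show ?thesis
  proof (induction A rule: sigma_sets_induct_disjoint)
    case (basic A)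
    then show ?case by (simp add: null_tests_closed)
  next
    case empty
    show ?case by (rule null_tests_cong[OF null_tests_zero]) simp
  next
    case (compl A)
    have "(\<lambda>x. indicator UNIV x + (-1) * indicator A x :: complex) \<in> null_tests"
      by (intro null_tests_add null_tests_cmult compl null_tests_closed) simp
    then show ?case by (rule null_tests_cong) (simp add: indicator_def)
  next
    case (union A)
    show ?case
    proof (rule null_tests_dominated_limit)
      show "(\<lambda>x. \<Sum>i<k. indicator (A i) x :: complex) \<in> null_tests" for k
        by (intro null_tests_sum union) simp
      have "(\<Union>i. A i) \<in> sets borel" using union(2) borel_sets by (intro sets.countable_UN) auto
      then show "(indicator (\<Union>i. A i) :: 'a \<Rightarrow> complex) \<in> borel_measurable M"
        by (intro borel_measurable_restrict) simp
      show "integrable M (\<lambda>x. 1 :: real)" by simp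
      have eq: "(\<Sum>i<k. indicator (A i) x :: complex) = indicator (\<Union>i<k. A i) x" for k x
        using union(1) by (intro indicator_UN_disjoint[symmetric]) (auto intro: disjoint_family_on_mono)
      show "norm (\<Sum>i<k. indicator (A i) x :: complex) \<le> 1" for k x
        unfolding eq by (simp add: indicator_def)
      show "(\<lambda>k. \<Sum>i<k. indicator (A i) x :: complex) \<longlonglongrightarrow> indicator (\<Union>i. A i) x" for x
        unfolding eq by (rule LIMSEQ_indicator_UN)
    qed
  qed
qed

lemma integrable_null_test:
  assumes "integrable M \<phi>"
  shows "\<phi> \<in> null_tests"
proof (rule null_tests_all[OF _ assms])
  fix A assume "A \<in> sets M"
  then obtain A' where A': "A' \<in> sets borel" "A = S \<inter> A'"
    by (auto simp: sets_M sets_restrict_space)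
  have "space M = S" using sets_eq_imp_space_eq[OF sets_M] by (simp add: space_restrict_space)
  then show "(indicator A :: 'a \<Rightarrow> complex) \<in> null_tests"
    by (intro null_tests_cong[OF null_tests_borel[OF A'(1)]]) (simp add: A' indicator_def)
qed

end

section \<open>Trigonometric polynomials as test functions\<close>
lemma compact_torus: "compact (torus :: (complex ^ 'n::finite) set)"
  unfolding compact_eq_bounded_closed
proof
  have "norm \<zeta> \<le> real CARD('n)" if "\<zeta> \<in> torus" for \<zeta> :: "complex ^ 'n"
  proof -
    have "norm \<zeta> \<le> (\<Sum>j\<in>UNIV. norm (\<zeta> $ j))" unfolding norm_vec_def by (rule L2_set_le_sum) simp
    also have "\<dots> = real CARD('n)" using that by (simp add: torus_def)
    finally show ?thesis .
  qed
  then show "bounded (torus :: (complex ^ 'n) set)" unfolding bounded_iff by blast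
  have eq: "torus = (\<Inter>j. {\<zeta> :: complex ^ 'n. norm (\<zeta> $ j) = 1})" by (auto simp: torus_def)
  show "closed (torus :: (complex ^ 'n) set)"
    unfolding eq by (intro closed_INT ballI closed_Collect_eq continuous_intros)
qed

lemma monomial_mult_coordinate:
  assumes "\<zeta> \<in> torus"
  shows "monomial m \<zeta> * \<zeta> $ j powi k = monomial (m(j := m j + k)) \<zeta>"
proof -
  have nz: "\<zeta> $ i \<noteq> 0" for i
  proof -
    have "norm (\<zeta> $ i) = 1" using assms by (simp add: torus_def)
    then show ?thesis by auto
  qed
  have "monomial (m(j := m j + k)) \<zeta> = (\<Prod>i\<in>UNIV. \<zeta> $ i powi m i * (if i = j then \<zeta> $ i powi k else 1))"
    unfolding monomial_def by (rule prod.cong) (auto simp: power_int_add nz)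
  also have "\<dots> = monomial m \<zeta> * \<zeta> $ j powi k"
    by (simp add: prod.distrib monomial_def)
  finally show ?thesis ..
qed

text \<open>
  On the torus it suffices to test monomials, by the Stone--Weierstrass theorem.
\<close>
locale torus_net = bounded_net M h G B
  for M :: "(complex ^ 'n::finite) measure" and h :: "'r \<Rightarrow> complex ^ 'n \<Rightarrow> complex" and G B +
  assumes sets_torus: "sets M = sets (restrict_space borel torus)"
    and monomial_null_test: "monomial m \<in> null_tests"
begin

lemma space_torus: "space M = torus"
  using sets_eq_imp_space_eq[OF sets_torus] by (simp add: space_restrict_space)

text \<open>
  The test functions as such are not closed under products, so real polynomials cannot be
  treated by induction directly. The induction works for the multipliers below: functions by which
  multiplication preserves the space of those \<open>\<psi>\<close> that are admissible after multiplication by every monomial.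
\<close>
definition multiplicands :: "(complex ^ 'n \<Rightarrow> complex) set" where
  "multiplicands = {\<psi>. \<forall>m. (\<lambda>x. monomial m x * \<psi> x) \<in> null_tests}"

definition multipliers :: "(complex ^ 'n \<Rightarrow> complex) set" where
  "multipliers = {p. \<forall>\<psi>\<in>multiplicands. (\<lambda>x. p x * \<psi> x) \<in> multiplicands}"

lemma multipliersD:
  "p \<in> multipliers \<Longrightarrow> \<psi> \<in> multiplicands \<Longrightarrow> (\<lambda>x. p x * \<psi> x) \<in> multiplicands"
  by (simp add: multipliers_def)

lemma multipliers_add:
  assumes "p \<in> multipliers" "q \<in> multipliers"
  shows "(\<lambda>x. p x + q x) \<in> multipliers"
  using assms null_tests_add by (auto simp: multipliers_def multiplicands_def algebra_simps)

lemma multipliers_cmult: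
  assumes "p \<in> multipliers"
  shows "(\<lambda>x. c * p x) \<in> multipliers"
proof -
  have "(\<lambda>x. monomial m x * (c * p x * \<psi> x)) \<in> null_tests" if "\<psi> \<in> multiplicands" for m \<psi>
  proof -
    have "(\<lambda>x. c * (monomial m x * (p x * \<psi> x))) \<in> null_tests"
      using assms that by (intro null_tests_cmult) (auto simp: multipliers_def multiplicands_def)
    then show ?thesis by (simp add: mult_ac)
  qed
  then show ?thesis by (simp add: multipliers_def multiplicands_def)
qed

lemma multipliers_mult:
  assumes "p \<in> multipliers" "q \<in> multipliers"
  shows "(\<lambda>x. p x * q x) \<in> multipliers"
  using assms by (simp add: multipliers_def mult.assoc)

lemma multipliers_const: "(\<lambda>x. c) \<in> multipliers"
proof -
  have "(\<lambda>x. 1) \<in> multipliers" by (simp add: multipliers_def)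
  from multipliers_cmult[OF this, of c] show ?thesis by simp
qed

lemma multipliers_sum:
  assumes "finite A" "\<And>i. i \<in> A \<Longrightarrow> p i \<in> multipliers"
  shows "(\<lambda>x. \<Sum>i\<in>A. p i x) \<in> multipliers"
  using assms by (induction A rule: finite_induct) (auto simp: multipliers_add multipliers_const)

lemma multipliers_cong:
  assumes "p \<in> multipliers" "\<And>x. x \<in> torus \<Longrightarrow> p x = q x"
  shows "q \<in> multipliers"
proof -
  have "(\<lambda>x. monomial m x * (q x * \<psi> x)) \<in> null_tests" if "\<psi> \<in> multiplicands" for m \<psi>
  proof (rule null_tests_cong)
    show "(\<lambda>x. monomial m x * (p x * \<psi> x)) \<in> null_tests"
      using assms(1) that by (simp add: multipliers_def multiplicands_def)
  qed (simp add: space_torus assms(2))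
  then show ?thesis by (simp add: multipliers_def multiplicands_def)
qed

lemma multipliers_coordinate: "(\<lambda>x. x $ j powi k) \<in> multipliers"
proof -
  have "(\<lambda>x. monomial m x * (x $ j powi k * \<psi> x)) \<in> null_tests" if "\<psi> \<in> multiplicands" for m \<psi>
  proof (rule null_tests_cong)
    show "(\<lambda>x. monomial (m(j := m j + k)) x * \<psi> x) \<in> null_tests"
      using that by (simp add: multiplicands_def)
  qed (simp add: space_torus flip: monomial_mult_coordinate)
  then show ?thesis by (simp add: multipliers_def multiplicands_def)
qed

text \<open>
  The real coordinates of \<open>\<complex>\<^sup>n\<close> are combinations of \<open>w\<close> and its conjugate, and on the torus the
  conjugate is the monomial \<open>w\<^bsup>-1\<^esup>\<close>.
\<close>
lemma multipliers_inner_Basis: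
  assumes "b \<in> Basis"
  shows "(\<lambda>x. of_real (x \<bullet> b)) \<in> multipliers"
proof -
  obtain j c where b: "b = axis j c" and c: "c = 1 \<or> c = \<i>"
    using assms by (auto simp: Basis_vec_def Basis_complex_def)
  have inv: "cnj (x $ j) = x $ j powi (-1)" if "x \<in> torus" for x :: "complex ^ 'n"
    using cnj_eq_inverse[of "x $ j"] that by (simp add: torus_def power_int_minus)
  have one: "x $ j powi 1 = x $ j" for x :: "complex ^ 'n" by simp
  from c show ?thesis
  proof
    assume c: "c = 1"
    have "(\<lambda>x. (1 / 2) * (x $ j powi 1 + x $ j powi (-1))) \<in> multipliers"
      by (intro multipliers_cmult multipliers_add multipliers_coordinate)
    then show ?thesis
    proof (rule multipliers_cong)
      fix x :: "complex ^ 'n" assume "x \<in> torus"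
      from inv[OF this, symmetric] show "(1 / 2) * (x $ j powi 1 + x $ j powi (-1)) = of_real (x \<bullet> b)"
        by (simp only: one b c inner_axis) (simp add: complex_eq_iff inner_complex_def)
    qed
  next
    assume c: "c = \<i>"
    have "(\<lambda>x. (1 / (2 * \<i>)) * (x $ j powi 1 + (-1) * (x $ j powi (-1)))) \<in> multipliers"
      by (intro multipliers_cmult multipliers_add multipliers_coordinate)
    then show ?thesis
    proof (rule multipliers_cong)
      fix x :: "complex ^ 'n" assume "x \<in> torus"
      from inv[OF this, symmetric] show "(1 / (2 * \<i>)) * (x $ j powi 1 + (-1) * (x $ j powi (-1))) = of_real (x \<bullet> b)"
        by (simp only: one b c inner_axis) (simp add: complex_eq_iff inner_complex_def)
    qed
  qed
qed

lemma multipliers_real_polynomial: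
  assumes "real_polynomial_function p"
  shows "(\<lambda>x. of_real (p x)) \<in> multipliers"
  using assms
proof (induction rule: real_polynomial_function.induct)
  case (linear l)
  have expand: "l x = (\<Sum>b\<in>Basis. l b * (x \<bullet> b))" for x
  proof -
    interpret bounded_linear l by (rule linear)
    have "l x = l (\<Sum>b\<in>Basis. (x \<bullet> b) *\<^sub>R b)" by (simp add: euclidean_representation)
    also have "\<dots> = (\<Sum>b\<in>Basis. l b * (x \<bullet> b))" by (simp add: sum scaleR mult.commute)
    finally show ?thesis .
  qed
  have "(\<lambda>x. \<Sum>b\<in>Basis. of_real (l b) * of_real (x \<bullet> b)) \<in> multipliers"
    by (intro multipliers_sum multipliers_cmult multipliers_inner_Basis) auto
  then show ?case
  proof (rule multipliers_cong)
    fix x show "(\<Sum>b\<in>Basis. of_real (l b) * of_real (x \<bullet> b)) = complex_of_real (l x)"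
      by (simp add: expand[of x])
  qed
qed (simp_all add: multipliers_const multipliers_add multipliers_mult)

lemma continuous_null_test:
  fixes g :: "complex ^ 'n \<Rightarrow> real"
  assumes g: "continuous_on UNIV g"
  shows "(\<lambda>x. of_real (g x)) \<in> null_tests"
proof (rule null_tests_uniform_closed)
  have "(\<lambda>x. complex_of_real (g x)) \<in> borel_measurable borel"
    by (intro borel_measurable_continuous_onI continuous_intros g)
  then show "(\<lambda>x. complex_of_real (g x)) \<in> borel_measurable M"
    unfolding measurable_cong_sets[OF sets_torus refl] by (rule measurable_restrict_space1)
  fix \<epsilon> :: real assume "\<epsilon> > 0"
  then obtain p where p: "real_polynomial_function p" "\<And>x. x \<in> torus \<Longrightarrow> \<bar>g x - p x\<bar> < \<epsilon>"
    using Stone_Weierstrass_real_polynomial_function[OF compact_torus continuous_on_subset[OF g]] by blast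
  have "(\<lambda>x. 1) \<in> multiplicands"
    using monomial_null_test by (simp add: multiplicands_def)
  from multipliersD[OF multipliers_real_polynomial[OF p(1)] this]
  have "(\<lambda>x. of_real (p x) * 1) \<in> multiplicands" .
  then have "(\<lambda>x. monomial (\<lambda>_. 0) x * (of_real (p x) * 1)) \<in> null_tests"
    unfolding multiplicands_def by blast
  then have "(\<lambda>x. complex_of_real (p x)) \<in> null_tests" by (simp add: monomial_def)
  moreover have "norm (complex_of_real (g x) - of_real (p x)) \<le> \<epsilon>" if "x \<in> space M" for x
    using p(2)[of x] that by (simp add: space_torus flip: of_real_diff)
  ultimately show "\<exists>\<psi>\<in>null_tests. \<forall>x\<in>space M. norm (complex_of_real (g x) - \<psi> x) \<le> \<epsilon>"
    by (intro bexI[of _ "\<lambda>x. complex_of_real (p x)"] ballI)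
qed

sublocale bounded_net_metric M h G B torus
  by standard (use sets_torus continuous_null_test in auto)

end

section \<open>Weak star convergence of Poisson integrals\<close>
lemma poisson_integral_cong_AE:
  fixes f g :: "complex ^ 'n \<Rightarrow> complex"
  assumes "AE x in torus_measure. f x = g x" "f \<in> borel_measurable torus_measure" "g \<in> borel_measurable torus_measure"
  shows "poisson_integral \<alpha> \<beta> f z = poisson_integral \<alpha> \<beta> g z"
proof -
  have [measurable]: "(\<lambda>\<zeta>::complex ^ 'n. \<zeta> $ j) \<in> borel_measurable torus_measure" for j
    by (intro borel_measurable_torusI borel_measurable_continuous_onI continuous_intros)
  have [measurable]: "cnj \<in> borel_measurable borel"
    by (intro borel_measurable_continuous_onI continuous_intros)
  note [measurable] = assms(2,3)
  have "(\<lambda>\<zeta>. poisson_kernel \<alpha> \<beta> z \<zeta>) \<in> borel_measurable torus_measure"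
    unfolding poisson_kernel_def by measurable
  then show ?thesis unfolding poisson_integral_def
    using assms by (intro integral_cong_AE) auto
qed

context
  fixes \<alpha> \<beta> :: "complex ^ 'n" and f :: "complex ^ 'n \<Rightarrow> complex" and C :: real and r :: "real ^ 'n"
  assumes f_measurable: "f \<in> borel_measurable torus_measure" and f_bounded: "\<And>x. norm (f x) \<le> C"
    and r: "\<And>j. 0 \<le> r $ j \<and> r $ j < 1"
begin

interpretation T: prob_space "torus_measure :: (complex ^ 'n) measure"
  by (rule prob_space_torus_measure)

interpretation TT: pair_sigma_finite "torus_measure :: (complex ^ 'n) measure" "torus_measure :: (complex ^ 'n) measure" ..

interpretation TP: prob_space "(torus_measure :: (complex ^ 'n) measure) \<Otimes>\<^sub>M (torus_measure :: (complex ^ 'n) measure)"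
  by (rule prob_space_pair) (rule prob_space_torus_measure)+

lemma poisson_integral_radial_measurable:
  "(\<lambda>\<zeta>. poisson_integral \<alpha> \<beta> f (radial r \<zeta>)) \<in> borel_measurable torus_measure"
proof -
  note [measurable] = f_measurable poisson_kernel_measurable[of \<alpha> \<beta> r]
  show ?thesis unfolding poisson_integral_def
    by (rule T.borel_measurable_lebesgue_integral) (simp add: case_prod_beta)
qed

lemma poisson_kernel_section_integrable:
  assumes "\<zeta> \<in> torus"
  shows "integrable torus_measure (poisson_kernel \<alpha> \<beta> (radial r \<zeta>))"
proof -
  obtain K where K: "\<And>\<zeta> \<eta>. \<zeta> \<in> torus \<Longrightarrow> \<eta> \<in> torus \<Longrightarrow> norm (poisson_kernel \<alpha> \<beta> (radial r \<zeta>) \<eta>) \<le> K"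
    using poisson_kernel_bounded[of r \<alpha> \<beta>] r by blast
  have "\<zeta> \<in> space torus_measure" using assms by (simp add: space_torus_measure)
  from measurable_compose[OF measurable_Pair1'[OF this] poisson_kernel_measurable]
  have "poisson_kernel \<alpha> \<beta> (radial r \<zeta>) \<in> borel_measurable torus_measure" by simp
  then show ?thesis
    by (intro T.integrable_const_bound[where B = K] AE_I2) (auto simp: space_torus_measure assms K)
qed

text \<open>
  The \<open>L\<^sup>1\<close> bound on the kernel is uniform in \<open>\<zeta>\<close>, so the dilations of a Poisson integral stay bounded as \<open>r\<close> approaches \<open>(1, ..., 1)\<close>.
\<close>
lemma poisson_integral_radial_bound:
  assumes "\<zeta> \<in> torus"
  shows "norm (poisson_integral \<alpha> \<beta> f (radial r \<zeta>)) \<le> poisson_L1_bound \<alpha> \<beta> r * C"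
proof -
  have C: "0 \<le> C" using f_bounded norm_ge_zero order_trans by blast
  let ?K = "poisson_kernel \<alpha> \<beta> (radial r \<zeta>)"
  have int: "integrable torus_measure ?K" by (rule poisson_kernel_section_integrable[OF assms])
  have intf: "integrable torus_measure (\<lambda>\<eta>. ?K \<eta> * f \<eta>)"
  proof (rule Bochner_Integration.integrable_bound)
    show "integrable torus_measure (\<lambda>\<eta>. norm (?K \<eta>) * C)" using int by simp
    show "(\<lambda>\<eta>. ?K \<eta> * f \<eta>) \<in> borel_measurable torus_measure"
      using borel_measurable_integrable[OF int] f_measurable by simp
    show "AE \<eta> in torus_measure. norm (?K \<eta> * f \<eta>) \<le> norm (norm (?K \<eta>) * C)"
      using C f_bounded by (intro AE_I2) (simp add: norm_mult mult_left_mono)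
  qed
  have "norm (poisson_integral \<alpha> \<beta> f (radial r \<zeta>)) \<le> (LINT \<eta>|torus_measure. norm (?K \<eta> * f \<eta>))"
    unfolding poisson_integral_def by (rule integral_norm_bound)
  also have "\<dots> \<le> (LINT \<eta>|torus_measure. norm (?K \<eta>) * C)"
    using int f_bounded
    by (intro integral_mono integrable_norm[OF intf]) (auto simp: norm_mult intro!: mult_left_mono)
  also have "\<dots> = (LINT \<eta>|torus_measure. norm (?K \<eta>)) * C" by simp
  also have "\<dots> \<le> poisson_L1_bound \<alpha> \<beta> r * C"
    using r C assms by (intro mult_right_mono poisson_kernel_L1) auto
  finally show ?thesis .
qed

text \<open>
  By Fubini's theorem the monomial can be integrated against the kernel first, where it is an
  eigenfunction.
\<close>
lemma poisson_integral_monomial: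
  "(LINT \<zeta>|torus_measure. monomial m \<zeta> * poisson_integral \<alpha> \<beta> f (radial r \<zeta>)) =
    (\<Prod>j\<in>UNIV. poisson_const (\<alpha> $ j) (\<beta> $ j) * kernel_multiplier (\<alpha> $ j) (\<beta> $ j) (m j) (r $ j)) *
    (LINT \<eta>|torus_measure. monomial m \<eta> * f \<eta>)"
proof -
  let ?K = "\<lambda>\<zeta> \<eta>. poisson_kernel \<alpha> \<beta> (radial r \<zeta>) \<eta>"
  let ?c = "\<Prod>j\<in>UNIV. poisson_const (\<alpha> $ j) (\<beta> $ j) * kernel_multiplier (\<alpha> $ j) (\<beta> $ j) (m j) (r $ j)"
  obtain K where K: "\<And>\<zeta> \<eta>. \<zeta> \<in> torus \<Longrightarrow> \<eta> \<in> torus \<Longrightarrow> norm (?K \<zeta> \<eta>) \<le> K"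
    using poisson_kernel_bounded[of r \<alpha> \<beta>] r by blast
  note [measurable] = f_measurable poisson_kernel_measurable[of \<alpha> \<beta> r] borel_measurable_torusI[OF monomial_measurable[of m]]
  have int: "integrable (torus_measure \<Otimes>\<^sub>M torus_measure) (\<lambda>(\<zeta>, \<eta>). monomial m \<zeta> * (?K \<zeta> \<eta> * f \<eta>))"
  proof (rule TP.integrable_const_bound[where B = "K * C"])
    show "(\<lambda>(\<zeta>, \<eta>). monomial m \<zeta> * (?K \<zeta> \<eta> * f \<eta>)) \<in> borel_measurable (torus_measure \<Otimes>\<^sub>M torus_measure)"
      unfolding case_prod_beta by measurable
    show "AE p in torus_measure \<Otimes>\<^sub>M torus_measure. norm (case p of (\<zeta>, \<eta>) \<Rightarrow> monomial m \<zeta> * (?K \<zeta> \<eta> * f \<eta>)) \<le> K * C"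
    proof (rule AE_I2)
      fix p :: "(complex ^ 'n) \<times> (complex ^ 'n)" assume "p \<in> space (torus_measure \<Otimes>\<^sub>M torus_measure)"
      then obtain \<zeta> \<eta> where p: "p = (\<zeta>, \<eta>)" "\<zeta> \<in> torus" "\<eta> \<in> torus"
        by (auto simp: space_pair_measure space_torus_measure)
      have "norm (?K \<zeta> \<eta>) * norm (f \<eta>) \<le> K * C"
        by (intro mult_mono' K p f_bounded) auto
      then show "norm (case p of (\<zeta>, \<eta>) \<Rightarrow> monomial m \<zeta> * (?K \<zeta> \<eta> * f \<eta>)) \<le> K * C"
        using p by (simp add: norm_mult norm_monomial)
    qed
  qed
  have "(LINT \<zeta>|torus_measure. monomial m \<zeta> * poisson_integral \<alpha> \<beta> f (radial r \<zeta>)) =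
     (LINT \<zeta>|torus_measure. (LINT \<eta>|torus_measure. monomial m \<zeta> * (?K \<zeta> \<eta> * f \<eta>)))"
    by (simp add: poisson_integral_def)
  also have "\<dots> = (LINT \<eta>|torus_measure. (LINT \<zeta>|torus_measure. monomial m \<zeta> * (?K \<zeta> \<eta> * f \<eta>)))"
    by (rule TT.Fubini_integral[symmetric]) (rule int)
  also have "\<dots> = (LINT \<eta>|torus_measure. ?c * (monomial m \<eta> * f \<eta>))"
  proof (rule Bochner_Integration.integral_cong[OF refl])
    fix \<eta> :: "complex ^ 'n" assume "\<eta> \<in> space torus_measure"
    then have \<eta>: "\<eta> \<in> torus" by (simp add: space_torus_measure)
    have "(LINT \<zeta>|torus_measure. monomial m \<zeta> * (?K \<zeta> \<eta> * f \<eta>)) = (LINT \<zeta>|torus_measure. monomial m \<zeta> * ?K \<zeta> \<eta>) * f \<eta>"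
      by (simp only: mult.assoc[symmetric] integral_mult_left_zero)
    then show "(LINT \<zeta>|torus_measure. monomial m \<zeta> * (?K \<zeta> \<eta> * f \<eta>)) = ?c * (monomial m \<eta> * f \<eta>)"
      using poisson_kernel_moment[OF r \<eta>, of m \<alpha> \<beta>] by (simp add: mult.assoc)
  qed
  also have "\<dots> = ?c * (LINT \<eta>|torus_measure. monomial m \<eta> * f \<eta>)"
    by (rule integral_mult_right_zero)
  finally show ?thesis .
qed

end

definition unit_cube :: "(real ^ 'n) set" where
  "unit_cube = {r. \<forall>j. 0 \<le> r $ j \<and> r $ j < 1}"

lemma filterlim_unit_cube_component:
  "filterlim (\<lambda>r :: real ^ 'n. r $ j) (at_left 1) (at 1 within unit_cube)"
proof -
  have "((\<lambda>r :: real ^ 'n. r $ j) \<longlongrightarrow> 1 $ j) (at 1 within unit_cube)"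
    by (intro tendsto_intros)
  moreover have "\<forall>\<^sub>F r :: real ^ 'n in at 1 within unit_cube. r $ j \<in> {..<1} \<and> r $ j \<noteq> 1"
    by (auto simp: eventually_at_filter unit_cube_def less_imp_neq)
  ultimately show ?thesis by (simp add: filterlim_at)
qed

text \<open>
  The difference \<open>u\<^sub>r - f\<close> is a bounded net on the torus, and against a monomial it integrates to
  \<open>(c\<^sub>r - 1)\<close> times a Fourier coefficient of \<open>f\<close>, where the product of multipliers \<open>c\<^sub>r\<close> tends to \<open>1\<close>.
\<close>
lemma weak_star_tendsto_bounded:
  fixes \<alpha> \<beta> :: "complex ^ 'n" and f :: "complex ^ 'n \<Rightarrow> complex"
  assumes pos: "\<And>j. Re (\<alpha> $ j) + Re (\<beta> $ j) > -1"
    and a: "\<And>j (k::nat). k \<ge> 1 \<Longrightarrow> \<alpha> $ j \<noteq> - of_nat k"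
    and b: "\<And>j (k::nat). k \<ge> 1 \<Longrightarrow> \<beta> $ j \<noteq> - of_nat k"
    and f: "f \<in> borel_measurable torus_measure" and C: "\<And>x. norm (f x) \<le> C"
  shows "weak_star_tendsto torus_measure (\<lambda>r \<zeta>. poisson_integral \<alpha> \<beta> f (radial r \<zeta>)) f (at 1 within unit_cube)"
proof -
  let ?G = "at 1 within unit_cube :: (real ^ 'n) filter"
  let ?T = "torus_measure :: (complex ^ 'n) measure"
  let ?U = "\<lambda>r \<zeta>. poisson_integral \<alpha> \<beta> f (radial r \<zeta>)"
  interpret T: prob_space ?T by (rule prob_space_torus_measure)
  have C0: "0 \<le> C" using C norm_ge_zero order_trans by blast
  have cube: "\<forall>\<^sub>F r in ?G. \<forall>j. 0 \<le> r $ j \<and> r $ j < 1"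
    by (auto simp: eventually_at_filter unit_cube_def)
  have "\<forall>j. \<exists>L. (kernel_L1_bound (\<alpha> $ j) (\<beta> $ j) \<longlongrightarrow> L) (at_left 1)"
    using kernel_L1_bound_tendsto pos by blast
  then obtain L where L: "\<And>j. (kernel_L1_bound (\<alpha> $ j) (\<beta> $ j) \<longlongrightarrow> L j) (at_left 1)" by metis
  define l where "l = (\<Prod>j\<in>UNIV. norm (poisson_const (\<alpha> $ j) (\<beta> $ j)) * L j)"
  have "(poisson_L1_bound \<alpha> \<beta> \<longlongrightarrow> l) ?G"
    unfolding poisson_L1_bound_def l_def
    by (intro tendsto_prod tendsto_mult tendsto_const filterlim_compose[OF L filterlim_unit_cube_component])
  then have bound: "\<forall>\<^sub>F r in ?G. poisson_L1_bound \<alpha> \<beta> r < l + 1"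
    by (rule order_tendstoD) simp
  define h where "h = (\<lambda>r \<zeta>. ?U r \<zeta> - f \<zeta>)"
  have bounded_U: "\<forall>\<^sub>F r in ?G. ?U r \<in> borel_measurable ?T \<and> (\<forall>x\<in>space ?T. norm (?U r x) \<le> (l + 1) * C)"
    using cube bound
  proof eventually_elim
    case (elim r)
    have "norm (?U r x) \<le> (l + 1) * C" if "x \<in> torus" for x
    proof -
      have "norm (?U r x) \<le> poisson_L1_bound \<alpha> \<beta> r * C"
        using elim by (intro poisson_integral_radial_bound f C that) auto
      also have "\<dots> \<le> (l + 1) * C" using elim C0 by (intro mult_right_mono) auto
      finally show ?thesis .
    qed
    moreover have "?U r \<in> borel_measurable ?T"
      by (rule poisson_integral_radial_measurable[OF f C]) (use elim in auto)
    ultimately show ?case by (simp add: space_torus_measure)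
  qed
  interpret N: bounded_net ?T h ?G "(l + 1) * C + C"
  proof
    show "\<forall>\<^sub>F r in ?G. h r \<in> borel_measurable ?T \<and> (\<forall>x\<in>space ?T. norm (h r x) \<le> (l + 1) * C + C)"
      using bounded_U
    proof eventually_elim
      case (elim r)
      have "norm (h r x) \<le> (l + 1) * C + C" if "x \<in> space ?T" for x
      proof -
        have "norm (h r x) \<le> norm (?U r x) + norm (f x)" unfolding h_def by (rule norm_triangle_ineq4)
        also have "\<dots> \<le> (l + 1) * C + C" using elim that C by (intro add_mono) auto
        finally show ?thesis .
      qed
      moreover have "h r \<in> borel_measurable ?T" unfolding h_def using elim f by (intro borel_measurable_diff) auto
      ultimately show ?case by blast
    qed
  qed
  have f_int: "integrable ?T (\<lambda>x. \<phi> x * f x)" if "integrable ?T \<phi>" for \<phi>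
  proof (rule Bochner_Integration.integrable_bound)
    show "integrable ?T (\<lambda>x. norm (\<phi> x) * C)" using that by simp
    show "(\<lambda>x. \<phi> x * f x) \<in> borel_measurable ?T" using borel_measurable_integrable[OF that] f by simp
    show "AE x in ?T. norm (\<phi> x * f x) \<le> norm (norm (\<phi> x) * C)"
      using C C0 by (intro AE_I2) (simp add: norm_mult mult_left_mono)
  qed
  have split: "\<forall>\<^sub>F r in ?G. (LINT x|?T. \<phi> x * ?U r x) = (LINT x|?T. \<phi> x * h r x) + (LINT x|?T. \<phi> x * f x)"
    if \<phi>: "integrable ?T \<phi>" for \<phi>
    using N.measurable_bounded
  proof eventually_elim
    case (elim r)
    then have "integrable ?T (\<lambda>x. \<phi> x * h r x)" by (intro N.integrable_mult_net \<phi>) auto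
    from Bochner_Integration.integral_add[OF this f_int[OF \<phi>]] show ?case
      by (simp add: h_def algebra_simps)
  qed
  have monomial: "monomial m \<in> N.null_tests" for m
  proof -
    have int: "integrable ?T (monomial m)"
      by (rule T.integrable_const_bound[where B = 1])
        (auto simp: space_torus_measure norm_monomial intro!: borel_measurable_torusI)
    let ?I = "LINT x|?T. monomial m x * f x"
    let ?c = "\<lambda>r. \<Prod>j\<in>UNIV. poisson_const (\<alpha> $ j) (\<beta> $ j) * kernel_multiplier (\<alpha> $ j) (\<beta> $ j) (m j) (r $ j)"
    have "(?c \<longlongrightarrow> (\<Prod>j\<in>(UNIV :: 'n set). 1)) ?G"
      by (intro tendsto_prod filterlim_compose[OF poisson_const_kernel_multiplier_tendsto filterlim_unit_cube_component] pos a b)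
    from tendsto_diff[OF tendsto_mult[OF this tendsto_const] tendsto_const, of ?I ?I] have "((\<lambda>r. ?c r * ?I - ?I) \<longlongrightarrow> 0) ?G" by simp
    moreover have "\<forall>\<^sub>F r in ?G. ?c r * ?I - ?I = (LINT x|?T. monomial m x * h r x)"
      using cube split[OF int]
    proof eventually_elim
      case (elim r)
      have "(LINT x|?T. monomial m x * ?U r x) = ?c r * ?I"
        by (rule poisson_integral_monomial[OF f C]) (use elim in auto)
      then show ?case using elim(2) by (metis add_diff_cancel_right')
    qed
    ultimately show ?thesis using int by (simp add: N.null_tests_def tendsto_cong)
  qed
  interpret N: torus_net ?T h ?G "(l + 1) * C + C"
    by standard (use monomial sets_torus_measure in auto)
  show ?thesis unfolding weak_star_tendsto_def
  proof (intro allI impI)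
    fix \<phi> :: "complex ^ 'n \<Rightarrow> complex" assume \<phi>: "integrable ?T \<phi>"
    have "((\<lambda>r. (LINT x|?T. \<phi> x * h r x) + (LINT x|?T. \<phi> x * f x)) \<longlongrightarrow> 0 + (LINT x|?T. \<phi> x * f x)) ?G"
      using N.integrable_null_test[OF \<phi>] by (intro tendsto_intros) (simp add: N.null_tests_def)
    then show "((\<lambda>r. LINT x|?T. \<phi> x * ?U r x) \<longlongrightarrow> (LINT x|?T. \<phi> x * f x)) ?G"
      unfolding tendsto_cong[OF split[OF \<phi>]] by simp
  qed
qed

theorem theorem3p15:
  fixes \<alpha> \<beta> :: "complex ^ 'n"
    and f u :: "complex ^ 'n \<Rightarrow> complex"
  assumes "\<And>j. Re (\<alpha> $ j) + Re (\<beta> $ j) > -1"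
    and "\<And>j (k::nat). k \<ge> 1 \<Longrightarrow> \<alpha> $ j \<noteq> - of_nat k"
    and "\<And>j (k::nat). k \<ge> 1 \<Longrightarrow> \<beta> $ j \<noteq> - of_nat k"
    and "f \<in> L_infinity torus_measure"
    and "\<And>z. z \<in> polydisc \<Longrightarrow> u z = poisson_integral \<alpha> \<beta> f z"
  shows "(\<forall>r \<in> {r :: real ^ 'n. \<forall>j. 0 \<le> r $ j \<and> r $ j < 1}.
            dilation u r \<in> L_infinity torus_measure) \<and>
         weak_star_tendsto torus_measure (dilation u) f
           (at (1 :: real ^ 'n) within {r. \<forall>j. 0 \<le> r $ j \<and> r $ j < 1})"
proof -
  let ?T = "torus_measure :: (complex ^ 'n) measure"
  obtain C where f: "f \<in> borel_measurable ?T" and C: "AE x in ?T. norm (f x) \<le> C"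
    using assms(4) by (auto simp: L_infinity_def)
  \<comment> \<open>A representative bounded everywhere, so that the uniform estimates apply.\<close>
  define g where "g = (\<lambda>x. if norm (f x) \<le> C then f x else 0)"
  have g: "g \<in> borel_measurable ?T" unfolding g_def using f by measurable
  have g_bound: "norm (g x) \<le> max C 0" for x by (auto simp: g_def)
  have fg: "AE x in ?T. f x = g x" using C by eventually_elim (simp add: g_def)
  have dil: "dilation u r \<zeta> = poisson_integral \<alpha> \<beta> g (radial r \<zeta>)" if "r \<in> unit_cube" "\<zeta> \<in> torus" for r \<zeta>
  proof -
    have "radial r \<zeta> \<in> polydisc" using that by (auto simp: polydisc_def radial_def unit_cube_def torus_def norm_mult)
    then have "dilation u r \<zeta> = poisson_integral \<alpha> \<beta> f (radial r \<zeta>)"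
      using assms(5) by (simp add: dilation_def radial_def)
    also have "\<dots> = poisson_integral \<alpha> \<beta> g (radial r \<zeta>)" by (rule poisson_integral_cong_AE[OF fg f g])
    finally show ?thesis .
  qed
  have "dilation u r \<in> L_infinity ?T" if r: "r \<in> unit_cube" for r
  proof -
    have rj: "0 \<le> r $ j \<and> r $ j < 1" for j using r by (simp add: unit_cube_def)
    have "(dilation u r \<in> borel_measurable ?T) = ((\<lambda>\<zeta>. poisson_integral \<alpha> \<beta> g (radial r \<zeta>)) \<in> borel_measurable ?T)"
      by (rule measurable_cong) (simp add: dil r space_torus_measure)
    moreover have "(\<lambda>\<zeta>. poisson_integral \<alpha> \<beta> g (radial r \<zeta>)) \<in> borel_measurable ?T"
      by (rule poisson_integral_radial_measurable[OF g g_bound rj])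
    moreover have "AE x in ?T. norm (dilation u r x) \<le> poisson_L1_bound \<alpha> \<beta> r * max C 0"
      by (rule AE_I2) (simp add: dil r space_torus_measure poisson_integral_radial_bound[OF g g_bound rj])
    ultimately show ?thesis unfolding L_infinity_def by blast
  qed
  moreover have "weak_star_tendsto ?T (dilation u) f (at 1 within unit_cube)"
    unfolding weak_star_tendsto_def
  proof (intro allI impI)
    fix \<phi> :: "complex ^ 'n \<Rightarrow> complex" assume \<phi>: "integrable ?T \<phi>"
    have "((\<lambda>r. LINT x|?T. \<phi> x * poisson_integral \<alpha> \<beta> g (radial r x)) \<longlongrightarrow> (LINT x|?T. \<phi> x * g x)) (at 1 within unit_cube)"
      using weak_star_tendsto_bounded[OF assms(1-3) g g_bound] \<phi> unfolding weak_star_tendsto_def by blast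
    moreover have "(LINT x|?T. \<phi> x * g x) = (LINT x|?T. \<phi> x * f x)"
      using fg f g borel_measurable_integrable[OF \<phi>] by (intro integral_cong_AE) auto
    moreover have "\<forall>\<^sub>F r in at 1 within unit_cube. (LINT x|?T. \<phi> x * poisson_integral \<alpha> \<beta> g (radial r x)) = (LINT x|?T. \<phi> x * dilation u r x)"
    proof -
      have "(LINT x|?T. \<phi> x * poisson_integral \<alpha> \<beta> g (radial r x)) = (LINT x|?T. \<phi> x * dilation u r x)" if "r \<in> unit_cube" for r
        by (rule Bochner_Integration.integral_cong[OF refl]) (simp add: dil that space_torus_measure)
      then show ?thesis by (auto simp: eventually_at_filter)
    qed
    ultimately show "((\<lambda>r. LINT x|?T. \<phi> x * dilation u r x) \<longlongrightarrow> (LINT x|?T. \<phi> x * f x)) (at 1 within unit_cube)"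
      by (simp only: tendsto_cong)
  qed
  ultimately show ?thesis by (simp add: unit_cube_def)
qed

end
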